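(* If the set $\mathbf{O}=\{K\in[\omega]^\omega : \mathbf{P}^K\neq\mathbf{NP}^K\}$ is Ramsey large, then $\mathbf{P}\neq\mathbf{NP}$.
   Context: Binary strings are identified with natural numbers via a fixed effective enumeration of $\{0,1\}^{<\omega}$, so that infinite oracles are identified with elements of $[\omega]^\omega$, the set of infinite subsets of $\omega$. The Ellentuck topology on $[\omega]^\omega$ has basic open sets $[a,A]=\{S\in[\omega]^\omega : S\cap(\max a+1)=a,\ S\setminus a\subseteq A\}$ for finite $a$ and infinite $A$ with $\min A>\max a$. A set is Ramsey large if it is comeager in the Ellentuck topology. *)

theory Defs
  imports "HOL-Analysis.Analysis" "HOL-Computational_Algebra.Polynomial"
begin

section \<open>Binary strings as natural numbers\<close>

text \<open>The length-lexicographic enumeration, with \<open>False\<close> as the bit 0: the index of \<open>w\<close> is the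
  number with binary expansion \<open>1w\<close>, minus one.\<close>

definition str_index :: "bool list \<Rightarrow> nat" where
  "str_index w = foldl (\<lambda>n b. 2 * n + (if b then 2 else 1)) 0 w"

lemma str_index_simps [simp]:
  "str_index [] = 0"
  "str_index (w @ [b]) = 2 * str_index w + (if b then 2 else 1)"
  by (simp_all add: str_index_def)

lemma bij_str_index: "bij str_index"
proof (rule bijI)
  have "str_index v = str_index w \<Longrightarrow> v = w" for v w
  proof (induction v arbitrary: w rule: rev_induct)
    case Nil
    then show ?case by (cases w rule: rev_cases) (auto split: if_splits)
  next
    case (snoc b v)
    then show ?case
    proof (cases w rule: rev_cases)
      case Nil
      with snoc.prems show ?thesis by (auto split: if_splits)
    next
      case (snoc w' b')
      with snoc.prems have "2 * str_index v + (if b then 2 else 1)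
          = 2 * str_index w' + (if b' then 2 else 1)" by simp
      then have "b = b' \<and> str_index v = str_index w'"
        by (cases b; cases b') (simp_all, presburger+)
      with snoc.IH snoc show ?thesis by simp
    qed
  qed
  then show "inj str_index" by (auto intro: injI)
  have "\<exists>w. str_index w = n" for n
  proof (induction n rule: less_induct)
    case (less n)
    show ?case
    proof (cases "n = 0")
      case True
      then show ?thesis by (auto intro: exI[of _ "[]"])
    next
      case False
      then obtain m b where n: "n = 2 * m + (if b then 2 else 1)"
      proof (cases "even n")
        case True
        with False have "n = 2 * (n div 2 - 1) + 2" by presburger
        then show ?thesis using that[of "n div 2 - 1" True] by simp
      next
        case False
        then have "n = 2 * (n div 2) + 1" by presburger
        then show ?thesis using that[of "n div 2" False] by simp
      qed
      then have "m < n" by (simp split: if_splits)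
      with less obtain w where "str_index w = m" by blast
      with n have "str_index (w @ [b]) = n" by simp
      then show ?thesis ..
    qed
  qed
  then show "surj str_index" unfolding surj_def by metis
qed


section \<open>Multitape (oracle) Turing machines\<close>

datatype symbol = Blank | Bit bool | Aux nat

datatype move = Left | Stay | Right

text \<open>A tape is infinite in both directions; the second component is the head position.\<close>

type_synonym tape = "(int \<Rightarrow> symbol) \<times> int"

type_synonym config = "nat \<times> tape list"

fun scanned :: "tape \<Rightarrow> symbol" where
  "scanned (t, h) = t h"

fun shift :: "move \<Rightarrow> int \<Rightarrow> int" where
  "shift Left h = h - 1"
| "shift Stay h = h"
| "shift Right h = h + 1"

fun write_move :: "symbol \<times> move \<Rightarrow> tape \<Rightarrow> tape" where
  "write_move (s, m) (t, h) = (t(h := s), shift m h)"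

text \<open>A transition \<open>(q, rs, q', as)\<close> applies in state \<open>q\<close> when the heads scan the symbols \<open>rs\<close>; the
  machine enters \<open>q'\<close> and performs on each tape the corresponding write and move of \<open>as\<close>.
  The field \<open>orac\<close> is \<open>None\<close> for an ordinary Turing machine, and \<open>Some (q, y, n)\<close> for an
  oracle machine with query state \<open>q\<close> and answer states \<open>y\<close> (yes) and \<open>n\<close> (no). Tape 0 is the
  input tape, tape 1 the query tape of an oracle machine.\<close>

record machine =
  tapes :: nat
  trans :: "(nat \<times> symbol list \<times> nat \<times> (symbol \<times> move) list) set"
  start :: nat
  accept :: nat
  orac :: "(nat \<times> nat \<times> nat) option"

text \<open>Finiteness of the transition set makes the sets of states and of tape symbols effectively
  finite.\<close>

definition wf_machine :: "machine \<Rightarrow> bool" where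
  "wf_machine M \<longleftrightarrow>
     finite (trans M) \<and> 1 \<le> tapes M \<and>
     (\<forall>(q, rs, q', as) \<in> trans M.
        length rs = tapes M \<and> length as = tapes M \<and> q \<noteq> accept M) \<and>
     (\<forall>q y n. orac M = Some (q, y, n) \<longrightarrow>
        2 \<le> tapes M \<and> q \<noteq> accept M \<and> (\<forall>(r, _) \<in> trans M. r \<noteq> q))"

definition ordinary :: "machine \<Rightarrow> bool" where
  "ordinary M \<longleftrightarrow> orac M = None"

definition deterministic :: "machine \<Rightarrow> bool" where
  "deterministic M \<longleftrightarrow>
     (\<forall>q rs q1 as1 q2 as2. (q, rs, q1, as1) \<in> trans M \<longrightarrow> (q, rs, q2, as2) \<in> trans M \<longrightarrow>
        q1 = q2 \<and> as1 = as2)"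

text \<open>The query is the maximal bit string starting in cell 0, whatever the head position. (Only
  finitely many cells of a reachable tape are non-blank, so the least number exists.)\<close>

definition query_word :: "tape \<Rightarrow> bool list" where
  "query_word T =
     (let n = (LEAST n. \<forall>b. fst T (int n) \<noteq> Bit b)
      in map (\<lambda>i. fst T (int i) = Bit True) [0..<n])"

inductive step :: "machine \<Rightarrow> nat set \<Rightarrow> config \<Rightarrow> config \<Rightarrow> bool" for M K where
  move: "(q, map scanned ts, q', as) \<in> trans M \<Longrightarrow>
     step M K (q, ts) (q', map2 write_move as ts)"
| query: "orac M = Some (q, y, n) \<Longrightarrow>
     step M K (q, ts) (if str_index (query_word (ts ! 1)) \<in> K then y else n, ts)"

definition input_tape :: "bool list \<Rightarrow> tape" where
  "input_tape x =
     (\<lambda>i. if 0 \<le> i \<and> i < int (length x) then Bit (x ! nat i) else Blank, 0)"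

definition blank_tape :: tape where
  "blank_tape = (\<lambda>_. Blank, 0)"

definition initial :: "machine \<Rightarrow> bool list \<Rightarrow> config" where
  "initial M x = (start M, input_tape x # replicate (tapes M - 1) blank_tape)"

definition accepts :: "machine \<Rightarrow> nat set \<Rightarrow> bool list \<Rightarrow> bool" where
  "accepts M K x \<longleftrightarrow> (\<exists>c. (step M K)\<^sup>*\<^sup>* (initial M x) c \<and> fst c = accept M)"

definition language :: "machine \<Rightarrow> nat set \<Rightarrow> bool list set" where
  "language M K = {x. accepts M K x}"

definition halts_within :: "machine \<Rightarrow> nat set \<Rightarrow> bool list \<Rightarrow> nat \<Rightarrow> bool" where
  "halts_within M K x t \<longleftrightarrow> (\<forall>n c. (step M K ^^ n) (initial M x) c \<longrightarrow> n \<le> t)"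

definition poly_time :: "machine \<Rightarrow> nat set \<Rightarrow> bool" where
  "poly_time M K \<longleftrightarrow> (\<exists>p :: nat poly. \<forall>x. halts_within M K x (poly p (length x)))"


section \<open>Complexity classes\<close>

definition P_oracle :: "nat set \<Rightarrow> bool list set set" where
  "P_oracle K = {language M K | M. wf_machine M \<and> deterministic M \<and> poly_time M K}"

definition NP_oracle :: "nat set \<Rightarrow> bool list set set" where
  "NP_oracle K = {language M K | M. wf_machine M \<and> poly_time M K}"

text \<open>An ordinary machine never consults its oracle, so the argument \<open>{}\<close> is a dummy.\<close>

definition P_class :: "bool list set set" where
  "P_class = {language M {} | M. wf_machine M \<and> ordinary M \<and> deterministic M \<and> poly_time M {}}"

definition NP_class :: "bool list set set" where
  "NP_class = {language M {} | M. wf_machine M \<and> ordinary M \<and> poly_time M {}}"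


section \<open>Baire category and the Ellentuck topology\<close>

definition nowhere_dense_in :: "'a topology \<Rightarrow> 'a set \<Rightarrow> bool" where
  "nowhere_dense_in X N \<longleftrightarrow> N \<subseteq> topspace X \<and> X interior_of (X closure_of N) = {}"

definition meager_in :: "'a topology \<Rightarrow> 'a set \<Rightarrow> bool" where
  "meager_in X S \<longleftrightarrow> (\<exists>F. countable F \<and> (\<forall>N\<in>F. nowhere_dense_in X N) \<and> S = \<Union>F)"

definition comeager_in :: "'a topology \<Rightarrow> 'a set \<Rightarrow> bool" where
  "comeager_in X S \<longleftrightarrow> S \<subseteq> topspace X \<and> meager_in X (topspace X - S)"

text \<open>Here \<open>\<Union>m\<in>a. {..m}\<close> is the initial segment \<open>max a + 1 = {0, \<dots>, max a}\<close> of the natural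
  numbers, and is empty when \<open>a\<close> is empty.\<close>

definition ellentuck_basic :: "nat set \<Rightarrow> nat set \<Rightarrow> nat set set" where
  "ellentuck_basic a A = {S. infinite S \<and> S \<inter> (\<Union>m\<in>a. {..m}) = a \<and> S - a \<subseteq> A}"

definition ellentuck :: "nat set topology" where
  "ellentuck = topology_generated_by
     {ellentuck_basic a A | a A. finite a \<and> infinite A \<and> (\<forall>m\<in>a. \<forall>n\<in>A. m < n)}"

lemma topspace_ellentuck: "topspace ellentuck = {S. infinite S}"
proof
  show "topspace ellentuck \<subseteq> {S. infinite S}"
    by (auto simp: ellentuck_def ellentuck_basic_def)
  have "{S. infinite S} = ellentuck_basic {} UNIV"
    by (simp add: ellentuck_basic_def)
  then show "{S. infinite S} \<subseteq> topspace ellentuck"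
    unfolding ellentuck_def topology_generated_by_topspace
    by (intro Union_upper) (simp, metis UNIV_I empty_iff finite.emptyI infinite_UNIV_nat)
qed

definition ramsey_large :: "nat set set \<Rightarrow> bool" where
  "ramsey_large S \<longleftrightarrow> comeager_in ellentuck S"

end

theory Submission
  imports Defs
begin

text \<open>Suppose P = NP and let \<open>K\<close> be a tally oracle, i.e. a set of indices of words \<open>0\<^sup>i\<close>. On an input of
  length \<open>m\<close>, a polynomially bounded oracle machine sees only the answers for \<open>0\<^sup>0, \<dots>, 0\<^sup>n\<close> with \<open>n\<close>
  polynomial in \<open>m\<close>. A deterministic oracle machine can write down this table of answers next to the
  padded input; deciding acceptance relative to a given table is an ordinary NP problem, hence in P.
  So P and NP agree relative to every tally oracle. The infinite tally oracles form the basic open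
  set \<open>[\<emptyset>, A]\<close>, where \<open>A\<close> is the set of all indices of words \<open>0\<^sup>i\<close>, and by the Baire category theorem
  for the Ellentuck topology every Ramsey large set meets it.\<close>

section \<open>Baire category in the Ellentuck topology\<close>

text \<open>Tally words keep the table short: there is one word of zeros per length, but
  exponentially many words in all. A table is only as long as its input, so the input is padded
  first. One fixed squaring machine, iterated as often as the time bound requires, replaces a
  separate machine for every polynomial. The padded length then has three roles: it limits the
  queries, it splits the string into an input and a table of equal length, and it is the clock of
  the simulation. The clock cannot be avoided, since membership in NP demands a time bound on every
  string, including tables that disagree with \<open>K\<close>, for which the simulated machine need
  not obey its own bound. A further constraint comes from the machine model: a machine has a single
  query state, so two machines are composed only if at most one of them asks queries. Hence all
  queries are made by the tabulating machine, and the decider supplied by P = NP is ordinary.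
  Nondeterminism is confined to the simulation, which must therefore match the simulated machine in
  both directions.\<close>

lemma ellentuck_basic_open:
  assumes "finite a" "infinite A" "\<forall>m\<in>a. \<forall>n\<in>A. m < n"
  shows "openin ellentuck (ellentuck_basic a A)"
  unfolding ellentuck_def using assms by (intro topology_generated_by_Basis) blast

lemma ellentuck_basic_self:
  assumes "infinite A" "\<forall>m\<in>a. \<forall>n\<in>A. m < n"
  shows "a \<union> A \<in> ellentuck_basic a A"
  using assms by (fastforce simp: ellentuck_basic_def)

text \<open>A set between \<open>S \<inter> {..<m}\<close> and \<open>S\<close> meets every basic
  condition that \<open>S\<close> meets once \<open>m\<close> exceeds the stem, and a finite
  intersection only needs the larger bound. So these sets form a neighbourhood base at
  \<open>S\<close>.\<close>

lemma ellentuck_open_contains_initial: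
  assumes "openin ellentuck W" "S \<in> W"
  shows "\<exists>k. \<forall>m\<ge>k. ellentuck_basic (S \<inter> {..<m}) (S \<inter> {m..}) \<subseteq> W"
proof -
  have "generate_topology_on {ellentuck_basic a A | a A. finite a \<and> infinite A \<and> (\<forall>m\<in>a. \<forall>n\<in>A. m < n)} W"
    using assms(1) by (simp add: ellentuck_def openin_topology_generated_by_iff)
  then show ?thesis using assms(2)
  proof induction
    case Empty
    then show ?case by simp
  next
    case (Int U V)
    then obtain k l where "\<forall>m\<ge>k. ellentuck_basic (S \<inter> {..<m}) (S \<inter> {m..}) \<subseteq> U"
      "\<forall>m\<ge>l. ellentuck_basic (S \<inter> {..<m}) (S \<inter> {m..}) \<subseteq> V" by blast
    then show ?case by (intro exI[of _ "max k l"]) auto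
  next
    case (UN \<U>)
    then show ?case by blast
  next
    case (Basis U)
    then obtain a A where U: "U = ellentuck_basic a A" "finite a" by blast
    then obtain k where k: "\<forall>x\<in>a. x < k" using finite_nat_set_iff_bounded by blast
    have S: "S \<inter> (\<Union>m\<in>a. {..m}) = a" "S - a \<subseteq> A" using Basis U by (auto simp: ellentuck_basic_def)
    have "ellentuck_basic (S \<inter> {..<m}) (S \<inter> {m..}) \<subseteq> U" if "m \<ge> k" for m
    proof
      fix R assume R: "R \<in> ellentuck_basic (S \<inter> {..<m}) (S \<inter> {m..})"
      have sub: "a \<subseteq> S \<inter> {..<m}" using k that S by fastforce
      have "S \<inter> {..<m} \<subseteq> R" using R by (auto simp: ellentuck_basic_def)
      moreover have "R \<subseteq> S" using R by (auto simp: ellentuck_basic_def)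
      moreover have "R \<inter> (\<Union>m\<in>a. {..m}) \<subseteq> a" using \<open>R \<subseteq> S\<close> S(1) by blast
      moreover have "R - a \<subseteq> A" using \<open>R \<subseteq> S\<close> S(2) by blast
      moreover have "a \<subseteq> R \<inter> (\<Union>m\<in>a. {..m})" using sub \<open>S \<inter> {..<m} \<subseteq> R\<close> by auto
      moreover have "infinite R" using R by (simp add: ellentuck_basic_def)
      ultimately show "R \<in> U" unfolding U ellentuck_basic_def by (simp add: subset_antisym)
    qed
    then show ?case by blast
  qed
qed

text \<open>One fusion step: the open set minus the closure of \<open>N\<close> is open and
  nonempty, so it contains a smaller basic set. The stem is made to grow strictly so that the union
  of the stems is infinite in the limit.\<close>

lemma ellentuck_avoid_nowhere_dense:
  assumes "finite a" "infinite A" "\<forall>m\<in>a. \<forall>n\<in>A. m < n" "nowhere_dense_in ellentuck N"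
  shows "\<exists>a' A'. finite a' \<and> infinite A' \<and> (\<forall>m\<in>a'. \<forall>n\<in>A'. m < n) \<and> a \<subset> a' \<and>
    ellentuck_basic a' A' \<subseteq> ellentuck_basic a A \<and> ellentuck_basic a' A' \<inter> N = {}"
proof -
  let ?U = "ellentuck_basic a A" and ?C = "ellentuck closure_of N"
  have U: "openin ellentuck ?U" using assms ellentuck_basic_open by blast
  have "\<not> ?U \<subseteq> ?C"
    using assms(4) interior_of_maximal[OF _ U] ellentuck_basic_self[OF assms(2,3)]
    by (auto simp: nowhere_dense_in_def)
  then obtain S where S: "S \<in> ?U - ?C" by blast
  have "openin ellentuck (?U - ?C)" using U by (simp add: openin_diff)
  then obtain k where k: "\<And>m. m \<ge> k \<Longrightarrow> ellentuck_basic (S \<inter> {..<m}) (S \<inter> {m..}) \<subseteq> ?U - ?C"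
    using ellentuck_open_contains_initial S by meson
  have inf: "infinite S" and aS: "a \<subseteq> S" using S by (auto simp: ellentuck_basic_def)
  then obtain s where s: "s \<in> S" "s \<notin> a" using assms(1) by (meson finite_subset subsetI)
  obtain l where l: "\<forall>x\<in>insert s a. x < l" using assms(1) finite_nat_set_iff_bounded
    by (metis finite_insert)
  \<comment> \<open>The bound \<open>k\<close> keeps the neighbourhood inside the open set, and
    \<open>l\<close> puts the fresh point \<open>s\<close> into the stem.\<close>
  define m where "m = max k l"
  have "infinite (S \<inter> {m..})"
  proof
    assume "finite (S \<inter> {m..})"
    then have "finite (S \<inter> {m..} \<union> {..<m})" by simp
    moreover have "S \<subseteq> S \<inter> {m..} \<union> {..<m}" by auto
    ultimately show False using inf finite_subset by blast
  qed
  moreover have "a \<subset> S \<inter> {..<m}" using aS s l by (auto simp: m_def)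
  moreover have "N \<subseteq> ?C"
    using assms(4) by (simp add: nowhere_dense_in_def closure_of_subset)
  then have "ellentuck_basic (S \<inter> {..<m}) (S \<inter> {m..}) \<inter> N = {}" using k[of m] by (auto simp: m_def)
  moreover have "ellentuck_basic (S \<inter> {..<m}) (S \<inter> {m..}) \<subseteq> ?U" using k[of m] by (auto simp: m_def)
  ultimately show ?thesis
    by (intro exI[of _ "S \<inter> {..<m}"] exI[of _ "S \<inter> {m..}"]) auto
qed

text \<open>The Baire category theorem by fusion: starting from the empty stem and \<open>A\<close>,
  the nowhere dense sets are avoided one after another, and the union of the stems lies in all the
  basic sets chosen.\<close>

lemma ramsey_large_meets:
  assumes "ramsey_large S" "infinite A"
  shows "\<exists>K\<in>S. infinite K \<and> K \<subseteq> A"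
proof -
  obtain F where F: "countable F" "\<forall>N\<in>F. nowhere_dense_in ellentuck N" "topspace ellentuck - S = \<Union>F"
    using assms(1) unfolding ramsey_large_def comeager_in_def meager_in_def
    by (elim exE conjE) (rule that)
  have nd0: "nowhere_dense_in ellentuck {}" by (simp add: nowhere_dense_in_def)
  \<comment> \<open>The empty set, itself nowhere dense, is added because
    \<open>from_nat_into\<close> enumerates a nonempty set.\<close>
  define N where "N = from_nat_into (insert {} F)"
  have rN: "range N = insert {} F" unfolding N_def using F by (intro range_from_nat_into) auto
  have nd: "nowhere_dense_in ellentuck (N i)" for i using rN F nd0 by (metis insert_iff rangeI)
  define ok :: "nat set \<times> nat set \<Rightarrow> bool" where "ok = (\<lambda>(a, A). finite a \<and> infinite A \<and> (\<forall>m\<in>a. \<forall>n\<in>A. m < n))"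
  define nxt where "nxt = (\<lambda>i (a, A) (a', A'). a \<subset> a' \<and> ellentuck_basic a' A' \<subseteq> ellentuck_basic a A
     \<and> ellentuck_basic a' A' \<inter> N i = {})"
  have "\<exists>f. f 0 = ({}, A) \<and> (\<forall>n::nat. ok (f n) \<and> nxt n (f n) (f (Suc n)))"
  proof -
    have "\<exists>f. \<forall>n::nat. (ok (f n) \<and> (n = 0 \<longrightarrow> f n = ({}, A))) \<and> nxt n (f n) (f (Suc n))"
    proof (rule dependent_nat_choice)
      show "\<exists>x. ok x \<and> ((0::nat) = 0 \<longrightarrow> x = ({}, A))" using assms(2) by (auto simp: ok_def)
    next
      fix x and n :: nat assume "ok x \<and> (n = 0 \<longrightarrow> x = ({}, A))"
      moreover obtain b B where x: "x = (b, B)" by (cases x)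
      ultimately have "finite b" "infinite B" "\<forall>m\<in>b. \<forall>n\<in>B. m < n" by (auto simp: ok_def)
      from ellentuck_avoid_nowhere_dense[OF this nd[of n]]
      obtain b' B' where "ok (b', B')" "nxt n x (b', B')" unfolding ok_def nxt_def x by auto
      then show "\<exists>y. (ok y \<and> (Suc n = 0 \<longrightarrow> y = ({}, A))) \<and> nxt n x y" by blast
    qed
    then show ?thesis by blast
  qed
  then obtain f where f: "f 0 = ({}, A)" "\<And>n. ok (f n)" "\<And>n. nxt n (f n) (f (Suc n))" by blast
  define a B where "a = (\<lambda>n. fst (f n))" and "B = (\<lambda>n. snd (f n))"
  have okn: "finite (a n)" "infinite (B n)" "\<forall>m\<in>a n. \<forall>k\<in>B n. m < k" for n
    using f(2)[of n] by (auto simp: ok_def a_def B_def split: prod.splits)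
  have step: "a n \<subset> a (Suc n)" "ellentuck_basic (a (Suc n)) (B (Suc n)) \<subseteq> ellentuck_basic (a n) (B n)"
    "ellentuck_basic (a (Suc n)) (B (Suc n)) \<inter> N n = {}" for n
    using f(3)[of n] by (auto simp: nxt_def a_def B_def split: prod.splits)
  have mono: "a i \<subseteq> a j" if "i \<le> j" for i j
    using that psubset_imp_subset[OF step(1)] by (rule lift_Suc_mono_le[of a, rotated])
  have anti: "ellentuck_basic (a j) (B j) \<subseteq> ellentuck_basic (a i) (B i)" if "i \<le> j" for i j
    using that step(2)
    by (rule lift_Suc_antimono_le[of "\<lambda>n. ellentuck_basic (a n) (B n)", rotated])
  define K where "K = (\<Union>n. a n)"
  have inf: "infinite K"
  proof
    assume fin: "finite K"
    have sub: "a n \<subseteq> K" for n by (auto simp: K_def)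
    \<comment> \<open>The stems grow strictly, so stem number \<open>Suc (card K)\<close> would have
      more elements than \<open>K\<close>.\<close>
    have "strict_mono (\<lambda>n. card (a n))"
      unfolding strict_mono_Suc_iff using psubset_card_mono[OF okn(1) step(1)] by blast
    then have "Suc (card K) \<le> card (a (Suc (card K)))" by (rule strict_mono_imp_increasing)
    moreover have "card (a (Suc (card K))) \<le> card K" using sub fin by (rule card_mono[rotated])
    ultimately show False by simp
  qed
  have mem: "K \<in> ellentuck_basic (a i) (B i)" for i
  proof -
    \<comment> \<open>The point \<open>a j \<union> B j\<close> of the later basic set lies in the
      earlier one, and this controls how \<open>a j\<close> extends \<open>a i\<close>.\<close>
    have *: "(a j \<union> B j) \<inter> (\<Union>m\<in>a i. {..m}) = a i" "(a j \<union> B j) - a i \<subseteq> B i" if "i \<le> j" for j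
    proof -
      have "a j \<union> B j \<in> ellentuck_basic (a i) (B i)"
        using anti[OF that] ellentuck_basic_self[OF okn(2,3)] by (rule subsetD)
      then show "(a j \<union> B j) \<inter> (\<Union>m\<in>a i. {..m}) = a i" "(a j \<union> B j) - a i \<subseteq> B i"
        unfolding ellentuck_basic_def by (simp_all only: mem_Collect_eq)
    qed
    have **: "\<exists>j\<ge>i. x \<in> a j" if xK: "x \<in> K" for x
    proof -
      obtain j where "x \<in> a j" using xK by (auto simp: K_def)
      then have "x \<in> a (max i j)" using mono[of j "max i j"] by auto
      then show ?thesis by (intro exI[of _ "max i j"]) auto
    qed
    have "K \<inter> (\<Union>m\<in>a i. {..m}) = a i"
    proof
      show "K \<inter> (\<Union>m\<in>a i. {..m}) \<subseteq> a i"
      proof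
        fix x assume x: "x \<in> K \<inter> (\<Union>m\<in>a i. {..m})"
        then obtain j where "j \<ge> i" "x \<in> a j" using ** by blast
        with *(1)[of j] x show "x \<in> a i" by blast
      qed
      show "a i \<subseteq> K \<inter> (\<Union>m\<in>a i. {..m})" by (auto simp: K_def)
    qed
    moreover have "K - a i \<subseteq> B i"
    proof
      fix x assume x: "x \<in> K - a i"
      then obtain j where "j \<ge> i" "x \<in> a j" using ** by blast
      with *(2)[of j] x show "x \<in> B i" by blast
    qed
    ultimately show ?thesis using inf by (simp add: ellentuck_basic_def)
  qed
  have "K \<subseteq> A" using mem[of 0] f(1) by (auto simp: a_def B_def ellentuck_basic_def)
  moreover have "K \<notin> N i" for i using mem[of "Suc i"] step(3)[of i] by blast
  then have "K \<notin> \<Union>F" using rN by (metis UnionE insertI2 rangeE)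
  then have "K \<in> S" using F(3) inf by (auto simp: topspace_ellentuck)
  ultimately show ?thesis using inf by blast
qed

section \<open>Deterministic runs and composition of machines\<close>

text \<open>Only the configurations passed before \<open>d\<close> must have exactly one successor;
  elsewhere \<open>R\<close> may branch. This is the shape of a deterministic preparation, or of a
  simulated query, inside a nondeterministic machine.\<close>

primrec det_run :: "('c \<Rightarrow> 'c \<Rightarrow> bool) \<Rightarrow> nat \<Rightarrow> 'c \<Rightarrow> 'c \<Rightarrow> bool" where
  "det_run R 0 c d \<longleftrightarrow> c = d"
| "det_run R (Suc m) c d \<longleftrightarrow> (\<exists>e. (\<forall>x. R c x \<longleftrightarrow> x = e) \<and> det_run R m e d)"

lemma det_run_relpowp_cases:
  assumes "det_run R m c d" "(R ^^ l) c e"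
  shows "l \<le> m \<or> (\<exists>k. l = m + k \<and> (R ^^ k) d e)"
  using assms
proof (induction m arbitrary: c l)
  case (Suc m)
  then obtain c1 where c1: "\<And>x. R c x \<longleftrightarrow> x = c1" "det_run R m c1 d" by auto
  show ?case
  proof (cases l)
    case (Suc l')
    with Suc.prems(2) have "\<exists>b. R c b \<and> (R ^^ l') b e" by (metis relpowp_Suc_D2)
    with c1(1) have "(R ^^ l') c1 e" by auto
    from Suc.IH[OF c1(2) this] show ?thesis using Suc by auto
  qed auto
qed auto

text \<open>Final states may be reached only after a deterministic segment, because they are terminal.\<close>

lemma det_run_reach_final:
  assumes "det_run R m c d" "\<And>e x. R e x \<Longrightarrow> \<not> F e"
  shows "(\<exists>e. R\<^sup>*\<^sup>* c e \<and> F e) \<longleftrightarrow> (\<exists>e. R\<^sup>*\<^sup>* d e \<and> F e)"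
  using assms(1)
proof (induction m arbitrary: c)
  case (Suc m)
  then obtain c1 where c1: "\<And>x. R c x \<longleftrightarrow> x = c1" "det_run R m c1 d" by auto
  have "(\<exists>e. R\<^sup>*\<^sup>* c e \<and> F e) \<longleftrightarrow> (\<exists>e. R\<^sup>*\<^sup>* c1 e \<and> F e)"
  proof safe
    fix e assume "R\<^sup>*\<^sup>* c e" "F e"
    then show "\<exists>e. R\<^sup>*\<^sup>* c1 e \<and> F e"
      using assms(2) c1(1) by (metis converse_rtranclpE)
  next
    fix e assume "R\<^sup>*\<^sup>* c1 e" "F e"
    then show "\<exists>e. R\<^sup>*\<^sup>* c e \<and> F e"
      using c1(1) by (metis converse_rtranclp_into_rtranclp)
  qed
  with Suc.IH[OF c1(2)] show ?case by simp
qed simp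

lemma det_run_halts:
  assumes "det_run R m c d" "\<And>l e. (R ^^ l) d e \<Longrightarrow> l \<le> t" "(R ^^ l) c e"
  shows "l \<le> m + t"
  using det_run_relpowp_cases[OF assms(1,3)] assms(2) by fastforce

lemma relpowp_det_run:
  assumes "(R ^^ m) c d" "\<And>c x y. R c x \<Longrightarrow> R c y \<Longrightarrow> x = y"
  shows "det_run R m c d"
  using assms(1)
proof (induction m arbitrary: c)
  case (Suc m)
  then obtain c1 where "R c c1" "(R ^^ m) c1 d" by (meson relpowp_Suc_D2)
  moreover have "R c x \<longleftrightarrow> x = c1" for x using \<open>R c c1\<close> assms(2) by blast
  ultimately show ?case using Suc.IH by auto
qed simp

text \<open>Steps have to correspond only at configurations that have a successor. Thus
  \<open>h\<close> may send the final state of one machine to the initial state of another, where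
  new steps become possible.\<close>

lemma det_run_map:
  assumes "det_run R m c d"
    and "\<And>c e. R c e \<Longrightarrow> I c \<Longrightarrow> I e"
    and "\<And>c x. I c \<Longrightarrow> Ex (R c) \<Longrightarrow> S (h c) x \<longleftrightarrow> (\<exists>e. R c e \<and> x = h e)"
    and "I c"
  shows "det_run S m (h c) (h d)"
  using assms(1,4)
proof (induction m arbitrary: c)
  case (Suc m)
  then obtain c1 where c1: "\<And>x. R c x \<longleftrightarrow> x = c1" "det_run R m c1 d" by auto
  then have "I c1" using assms(2) Suc.prems by blast
  moreover have "S (h c) x \<longleftrightarrow> x = h c1" for x using assms(3)[OF \<open>I c\<close>] c1(1) by auto
  ultimately show ?case using Suc.IH c1(2) by auto
qed simp

section \<open>Single machine steps and sequential composition\<close>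

definition reply :: "nat set \<Rightarrow> tape list \<Rightarrow> nat \<Rightarrow> nat \<Rightarrow> nat" where
  "reply K ts y n = (if str_index (query_word (ts ! 1)) \<in> K then y else n)"

lemma step_iff:
  "step M K (q, ts) x \<longleftrightarrow>
    (\<exists>q' as. (q, map scanned ts, q', as) \<in> trans M \<and> x = (q', map2 write_move as ts)) \<or>
    (\<exists>y n. orac M = Some (q, y, n) \<and> x = (reply K ts y n, ts))"
  unfolding reply_def by (subst step.simps) blast

lemma wf_machineD:
  assumes "wf_machine M"
  shows "finite (trans M)" "1 \<le> tapes M"
    "(q, rs, q', as) \<in> trans M \<Longrightarrow> length rs = tapes M \<and> length as = tapes M \<and> q \<noteq> accept M"
    "orac M = Some (p, y, n) \<Longrightarrow> 2 \<le> tapes M \<and> p \<noteq> accept M"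
    "orac M = Some (p, y, n) \<Longrightarrow> (p, rs, q', as) \<notin> trans M"
  using assms unfolding wf_machine_def by fast+

lemma step_not_accept: "wf_machine M \<Longrightarrow> step M K c c' \<Longrightarrow> fst c \<noteq> accept M"
  by (cases c) (auto simp: step_iff dest: wf_machineD)

lemma step_deterministic:
  assumes "wf_machine M" "deterministic M" "step M K c x" "step M K c y"
  shows "x = y"
  using assms(3,4) wf_machineD(5)[OF assms(1)] assms(2)
  by (cases c) (fastforce simp: step_iff deterministic_def)

lemma step_length:
  assumes "wf_machine M" "step M K c c'" "length (snd c) = tapes M"
  shows "length (snd c') = tapes M"
  using assms by (cases c) (auto simp: step_iff dest: wf_machineD)

lemma ordinary_step: "ordinary M \<Longrightarrow> step M K = step M K'"
  by (intro ext) (auto simp: step_iff ordinary_def split: prod.splits)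

lemma ordinary_language: "ordinary M \<Longrightarrow> language M K = language M K'"
  using ordinary_step[of M K K'] by (simp add: language_def accepts_def)

lemma ordinary_poly_time: "ordinary M \<Longrightarrow> poly_time M K = poly_time M K'"
  using ordinary_step[of M K K'] by (simp add: poly_time_def halts_within_def)

text \<open>A three-tape machine \<open>T\<close> is run before \<open>D\<close> on tapes 0, 1 and the last tape of \<open>D\<close>; its final state
  is identified with the initial state of \<open>D\<close>.\<close>

definition three :: "nat \<Rightarrow> tape list \<Rightarrow> tape list" where
  "three n ts = ts ! 0 # ts ! 1 # replicate n blank_tape @ [ts ! 2]"

definition seq_state :: "machine \<Rightarrow> machine \<Rightarrow> nat \<Rightarrow> nat" where
  "seq_state T D q = (if q = accept T then 2 * start D + 1 else 2 * q)"

text \<open>The parity of a state tells whose state it is. The copied transitions of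
  \<open>T\<close> read and write blanks on the middle tapes, hence apply only while these are
  untouched. Only one query state is available, so the composition is meaningful when at most one of
  \<open>T\<close> and \<open>D\<close> asks queries.\<close>

definition seq :: "machine \<Rightarrow> machine \<Rightarrow> machine" where
  "seq T D = \<lparr>tapes = tapes D,
     trans =
       (\<lambda>(q, rs, q', as). (2 * q, rs ! 0 # rs ! 1 # replicate (tapes D - 3) Blank @ [rs ! 2],
           seq_state T D q', as ! 0 # as ! 1 # replicate (tapes D - 3) (Blank, Stay) @ [as ! 2]))
         ` trans T \<union>
       (\<lambda>(q, rs, q', as). (2 * q + 1, rs, 2 * q' + 1, as)) ` trans D,
     start = seq_state T D (start T), accept = 2 * accept D + 1,
     orac = (case orac D of
         Some (q, y, n) \<Rightarrow> Some (2 * q + 1, 2 * y + 1, 2 * n + 1)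
       | None \<Rightarrow> map_option (\<lambda>(q, y, n). (2 * q, seq_state T D y, seq_state T D n)) (orac T))\<rparr>"

lemma seq_simps [simp]:
  "tapes (seq T D) = tapes D" "start (seq T D) = seq_state T D (start T)"
  "accept (seq T D) = 2 * accept D + 1"
  by (simp_all add: seq_def)

lemma seq_trans:
  "(p, rs', p', as') \<in> trans (seq T D) \<longleftrightarrow>
    (\<exists>q rs q' as. (q, rs, q', as) \<in> trans T \<and> p = 2 * q \<and> p' = seq_state T D q' \<and>
       rs' = rs ! 0 # rs ! 1 # replicate (tapes D - 3) Blank @ [rs ! 2] \<and>
       as' = as ! 0 # as ! 1 # replicate (tapes D - 3) (Blank, Stay) @ [as ! 2]) \<or>
    (\<exists>q q'. (q, rs', q', as') \<in> trans D \<and> p = 2 * q + 1 \<and> p' = 2 * q' + 1)"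
  by (force simp: seq_def)

lemma seq_orac:
  assumes "orac T = None \<or> orac D = None"
  shows "orac (seq T D) = Some (p, y, n) \<longleftrightarrow>
    (\<exists>q y' n'. orac T = Some (q, y', n') \<and> p = 2 * q \<and> y = seq_state T D y' \<and> n = seq_state T D n') \<or>
    (\<exists>q y' n'. orac D = Some (q, y', n') \<and> p = 2 * q + 1 \<and> y = 2 * y' + 1 \<and> n = 2 * n' + 1)"
  using assms by (auto simp: seq_def split: option.splits)

lemma wf_seq:
  assumes "wf_machine T" "wf_machine D" "tapes T = 3" "3 \<le> tapes D" "orac T = None \<or> orac D = None"
  shows "wf_machine (seq T D)"
proof -
  note T = wf_machineD[OF assms(1)] and D = wf_machineD[OF assms(2)]
  have odd: "2 * q \<noteq> 2 * q' + 1" for q q' :: nat by presburger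
  have "finite (trans (seq T D))" using T(1) D(1) by (simp add: seq_def)
  moreover have "length rs = tapes D \<and> length as = tapes D \<and> p \<noteq> 2 * accept D + 1"
    if "(p, rs, p', as) \<in> trans (seq T D)" for p rs p' as
    using that T(3) D(3) assms(3,4) odd unfolding seq_trans by fastforce
  moreover have "2 \<le> tapes D \<and> p \<noteq> 2 * accept D + 1 \<and> (p, rs, p', as) \<notin> trans (seq T D)"
    if "orac (seq T D) = Some (p, y, n)" for p y n rs p' as
    using that T(4,5) D(4,5) assms(3,4) odd odd[symmetric] unfolding seq_trans seq_orac[OF assms(5)] by fastforce
  ultimately show ?thesis unfolding wf_machine_def using assms(4) by auto
qed

lemma deterministic_seq:
  assumes "wf_machine T" "deterministic T" "deterministic D" "tapes T = 3"
  shows "deterministic (seq T D)"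
proof -
  have len: "length rs = 3" if "(q, rs, q', as) \<in> trans T" for q rs q' as
    using wf_machineD(3)[OF assms(1) that] assms(4) by simp
  have eq: "rs = rs2" if "length rs = 3" "length rs2 = 3" "rs ! 0 = rs2 ! 0" "rs ! 1 = rs2 ! 1"
    "rs ! 2 = rs2 ! 2" for rs rs2 :: "symbol list"
    using that by (intro nth_equalityI) (auto simp: less_Suc_eq numeral_3_eq_3 numeral_2_eq_2)
  have odd: "2 * q \<noteq> Suc (2 * q')" for q q' :: nat by presburger
  show ?thesis unfolding deterministic_def
  proof (intro allI impI)
    fix p rs p1 as1 p2 as2
    assume a: "(p, rs, p1, as1) \<in> trans (seq T D)" "(p, rs, p2, as2) \<in> trans (seq T D)"
    show "p1 = p2 \<and> as1 = as2"
    proof (cases "even p")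
      case True
      then have "p \<noteq> 2 * q + 1" for q by auto
      have T: "\<exists>q r q' b. (q, r, q', b) \<in> trans T \<and> p = 2 * q \<and> p' = seq_state T D q' \<and>
           rs = r ! 0 # r ! 1 # replicate (tapes D - 3) Blank @ [r ! 2] \<and>
           as = b ! 0 # b ! 1 # replicate (tapes D - 3) (Blank, Stay) @ [b ! 2]"
        if "(p, rs, p', as) \<in> trans (seq T D)" for p' as
        using that \<open>\<And>q. p \<noteq> 2 * q + 1\<close> unfolding seq_trans by blast
      from T[OF a(1)] obtain q r1 q1 b1 where
        t1: "(q, r1, q1, b1) \<in> trans T" "p = 2 * q" "p1 = seq_state T D q1"
        "rs = r1 ! 0 # r1 ! 1 # replicate (tapes D - 3) Blank @ [r1 ! 2]"
        "as1 = b1 ! 0 # b1 ! 1 # replicate (tapes D - 3) (Blank, Stay) @ [b1 ! 2]" by blast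
      from T[OF a(2)] obtain q' r2 q2 b2 where
        t2: "(q', r2, q2, b2) \<in> trans T" "p = 2 * q'" "p2 = seq_state T D q2"
        "rs = r2 ! 0 # r2 ! 1 # replicate (tapes D - 3) Blank @ [r2 ! 2]"
        "as2 = b2 ! 0 # b2 ! 1 # replicate (tapes D - 3) (Blank, Stay) @ [b2 ! 2]" by blast
      have "q' = q" using t1 t2 by simp
      have "r1 = r2" using eq len[OF t1(1)] len[OF t2(1)] t1(4) t2(4) by simp
      with t1 t2 \<open>q' = q\<close> assms(2) have "q1 = q2 \<and> b1 = b2" unfolding deterministic_def by blast
      with t1 t2 show ?thesis by simp
    next
      case False
      then have "p \<noteq> 2 * q" for q by auto
      with a assms(3) show ?thesis unfolding seq_trans deterministic_def by auto
    qed
  qed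
qed

lemma list3: "length ts = 3 \<Longrightarrow> \<exists>a b c. ts = [a, b, c]"
  by (auto simp: numeral_3_eq_3 length_Suc_conv)

lemma map2_replicate_blank:
  "map2 write_move (replicate n (Blank, Stay)) (replicate n blank_tape) = replicate n blank_tape"
  by (simp add: zip_replicate blank_tape_def fun_upd_idem)

lemma seq_step_first:
  assumes "wf_machine T" "tapes T = 3" "3 \<le> tapes D" "orac T = None \<or> orac D = None"
    and "length ts = 3" "q \<noteq> accept T"
  shows "step (seq T D) K (seq_state T D q, three (tapes D - 3) ts) x \<longleftrightarrow>
    (\<exists>q' ts'. step T K (q, ts) (q', ts') \<and> x = (seq_state T D q', three (tapes D - 3) ts'))"
proof -
  obtain a b c where ts: "ts = [a, b, c]" using list3[OF assms(5)] by blast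
  let ?n = "tapes D - 3"
  have s: "map scanned (three ?n ts) = map scanned ts ! 0 # map scanned ts ! 1 # replicate ?n Blank @ [map scanned ts ! 2]"
    by (simp add: three_def ts blank_tape_def)
  have w: "map2 write_move (as ! 0 # as ! 1 # replicate ?n (Blank, Stay) @ [as ! 2]) (three ?n ts)
     = three ?n (map2 write_move as ts)" if "length as = 3" for as
    using list3[OF that] map2_replicate_blank by (auto simp: three_def ts)
  have odd: "2 * q \<noteq> Suc (2 * q')" for q q' :: nat by presburger
  have q: "seq_state T D q = 2 * q" using assms(6) by (simp add: seq_state_def)
  have l: "length rs = 3 \<and> length as = 3" if "(q, rs, q', as) \<in> trans T" for q rs q' as
    using wf_machineD(3)[OF assms(1) that] assms(2) by simp
  have e: "rs = map scanned ts" if "length rs = 3" "rs ! 0 = scanned a" "rs ! 1 = scanned b"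
    "rs ! 2 = scanned c" for rs
    using list3[OF that(1)] that by (auto simp: ts)
  have 1: "(2 * q, map scanned (three ?n ts), p', as') \<in> trans (seq T D) \<longleftrightarrow>
     (\<exists>q' as. (q, map scanned ts, q', as) \<in> trans T \<and> p' = seq_state T D q' \<and>
        as' = as ! 0 # as ! 1 # replicate ?n (Blank, Stay) @ [as ! 2])" for p' as'
    unfolding seq_trans s using odd l e by (fastforce simp: ts)
  have 2: "reply K (three ?n ts) (seq_state T D y) (seq_state T D n) = seq_state T D (reply K ts y n)" for y n
    by (simp add: reply_def three_def)
  show ?thesis (is "?L \<longleftrightarrow> ?R")
  proof
    assume ?L
    then show ?R
      unfolding q step_iff 1 seq_orac[OF assms(4)]
    proof (elim disjE exE conjE)
      fix p' as' q' as
      assume t: "(q, map scanned ts, q', as) \<in> trans T" and p': "p' = seq_state T D q'"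
        and as': "as' = as ! 0 # as ! 1 # replicate ?n (Blank, Stay) @ [as ! 2]"
        and x: "x = (p', map2 write_move as' (three ?n ts))"
      from l[OF t] have "length as = 3" by simp
      with x p' have "x = (seq_state T D q', three ?n (map2 write_move as ts))"
        unfolding as' by (simp only: w)
      with t show "\<exists>q' ts'. ((\<exists>q'' as. (q, map scanned ts, q'', as) \<in> trans T \<and> (q', ts') = (q'', map2 write_move as ts)) \<or>
          (\<exists>y n. orac T = Some (q, y, n) \<and> (q', ts') = (reply K ts y n, ts))) \<and> x = (seq_state T D q', three ?n ts')"
        by blast
    next
      fix y n q2 y' n' assume "x = (reply K (three ?n ts) y n, three ?n ts)" "orac T = Some (q2, y', n')"
        "2 * q = 2 * q2" "y = seq_state T D y'" "n = seq_state T D n'"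
      then show "\<exists>q' ts'. ((\<exists>q'' as. (q, map scanned ts, q'', as) \<in> trans T \<and> (q', ts') = (q'', map2 write_move as ts)) \<or>
          (\<exists>y n. orac T = Some (q, y, n) \<and> (q', ts') = (reply K ts y n, ts))) \<and> x = (seq_state T D q', three ?n ts')"
        using 2 by auto
    qed (use odd in auto)
  next
    assume ?R
    then obtain q' ts' where st: "step T K (q, ts) (q', ts')" and x: "x = (seq_state T D q', three ?n ts')"
      by blast
    from st show ?L unfolding step_iff[of T]
    proof (elim disjE exE conjE)
      fix q'' as assume t: "(q, map scanned ts, q'', as) \<in> trans T" and e: "(q', ts') = (q'', map2 write_move as ts)"
      from l[OF t] have "length as = 3" by simp
      from w[OF this] have "x = (seq_state T D q', map2 write_move (as ! 0 # as ! 1 # replicate ?n (Blank, Stay) @ [as ! 2]) (three ?n ts))"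
        using x e by simp
      with t e show ?L unfolding q step_iff 1 by blast
    next
      fix y n assume "orac T = Some (q, y, n)" "(q', ts') = (reply K ts y n, ts)"
      moreover from this have "orac (seq T D) = Some (2 * q, seq_state T D y, seq_state T D n)"
        unfolding seq_orac[OF assms(4)] by blast
      ultimately show ?L unfolding q step_iff x using 2 by auto
    qed
  qed
qed

lemma seq_step_second:
  assumes "orac T = None \<or> orac D = None"
  shows "step (seq T D) K (2 * q + 1, ts) x \<longleftrightarrow>
    (\<exists>q' ts'. step D K (q, ts) (q', ts') \<and> x = (2 * q' + 1, ts'))"
proof -
  have odd: "2 * q \<noteq> 2 * q' + 1" for q q' :: nat by presburger
  have r: "reply K ts (2 * y + 1) (2 * n + 1) = 2 * reply K ts y n + 1" for y n
    by (simp add: reply_def)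
  have 1: "(2 * q + 1, rs, p', as) \<in> trans (seq T D) \<longleftrightarrow>
      (\<exists>q'. (q, rs, q', as) \<in> trans D \<and> p' = 2 * q' + 1)" for rs p' as
    unfolding seq_trans using odd[symmetric] by auto
  have 2: "orac (seq T D) = Some (2 * q + 1, y, n) \<longleftrightarrow>
      (\<exists>y' n'. orac D = Some (q, y', n') \<and> y = 2 * y' + 1 \<and> n = 2 * n' + 1)" for y n
    unfolding seq_orac[OF assms] using odd[symmetric] by auto
  show ?thesis unfolding step_iff 1 2 using r by fastforce
qed

lemma seq_det_run_first:
  assumes "wf_machine T" "tapes T = 3" "3 \<le> tapes D" "orac T = None \<or> orac D = None"
    and "det_run (step T K) m (q, ts) (accept T, ts')" "length ts = 3"
  shows "det_run (step (seq T D) K) m (seq_state T D q, three (tapes D - 3) ts)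
    (2 * start D + 1, three (tapes D - 3) ts')"
proof -
  let ?h = "\<lambda>(q, ts). (seq_state T D q, three (tapes D - 3) ts)"
  have "det_run (step (seq T D) K) m (?h (q, ts)) (?h (accept T, ts'))"
  proof (rule det_run_map[where I = "\<lambda>c. length (snd c) = 3", OF assms(5)])
    fix c e assume "step T K c e" "length (snd c) = 3"
    then show "length (snd e) = 3" using step_length[OF assms(1)] assms(2) by simp
  next
    fix c x assume c: "length (snd c) = 3" "Ex (step T K c)"
    then have "fst c \<noteq> accept T" using step_not_accept[OF assms(1)] by blast
    with seq_step_first[OF assms(1-4), of "snd c" "fst c" K x] c
    show "step (seq T D) K (?h c) x = (\<exists>e. step T K c e \<and> x = ?h e)"
      by (cases c) auto
  qed (use assms(6) in simp)
  then show ?thesis by (simp add: seq_state_def)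
qed

lemma seq_relpowp_second:
  assumes "orac T = None \<or> orac D = None"
  shows "(step (seq T D) K ^^ l) (2 * q + 1, ts) x \<longleftrightarrow>
    (\<exists>q' ts'. (step D K ^^ l) (q, ts) (q', ts') \<and> x = (2 * q' + 1, ts'))"
proof (induction l arbitrary: x)
  case (Suc l)
  have "(step (seq T D) K ^^ Suc l) (2 * q + 1, ts) x \<longleftrightarrow>
     (\<exists>q' ts'. (step D K ^^ l) (q, ts) (q', ts') \<and> step (seq T D) K (2 * q' + 1, ts') x)"
    using Suc.IH by (auto simp: relcompp_apply)
  then show ?case unfolding seq_step_second[OF assms] by (auto simp: relcompp_apply)
qed auto

lemma seq_second:
  assumes "orac T = None \<or> orac D = None"
  shows "(\<exists>e. (step (seq T D) K)\<^sup>*\<^sup>* (2 * q + 1, ts) e \<and> fst e = accept (seq T D)) \<longleftrightarrow>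
    (\<exists>e. (step D K)\<^sup>*\<^sup>* (q, ts) e \<and> fst e = accept D)"
  unfolding rtranclp_power seq_relpowp_second[OF assms] by fastforce

text \<open>The run of \<open>T\<close> is a deterministic prefix that ends in the initial state of
  \<open>D\<close>; it cannot affect acceptance, and its length is added to the running
  time.\<close>

lemma seq_behaviour:
  assumes "wf_machine T" "wf_machine D" "tapes T = 3" "3 \<le> tapes D" "orac T = None \<or> orac D = None"
    and "det_run (step T K) m (start T, [input_tape x, blank_tape, blank_tape]) (accept T, ts)"
  shows "accepts (seq T D) K x \<longleftrightarrow>
      (\<exists>e. (step D K)\<^sup>*\<^sup>* (start D, three (tapes D - 3) ts) e \<and> fst e = accept D)"
    and "(\<And>l e. (step D K ^^ l) (start D, three (tapes D - 3) ts) e \<Longrightarrow> l \<le> t) \<Longrightarrow>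
      halts_within (seq T D) K x (m + t)"
proof -
  let ?n = "tapes D - 3"
  have "tapes D - 1 = Suc ?n + 1" using assms(4) by simp
  then have "replicate (tapes D - 1) blank_tape = replicate (Suc ?n + 1) blank_tape" by presburger
  also have "\<dots> = blank_tape # replicate ?n blank_tape @ [blank_tape]"
    unfolding replicate_add by simp
  finally have init: "initial (seq T D) x =
      (seq_state T D (start T), three ?n [input_tape x, blank_tape, blank_tape])"
    by (simp add: initial_def three_def)
  have run: "det_run (step (seq T D) K) m (initial (seq T D) x) (2 * start D + 1, three ?n ts)"
    unfolding init by (rule seq_det_run_first[OF assms(1,3-6)]) simp
  show "accepts (seq T D) K x \<longleftrightarrow>
      (\<exists>e. (step D K)\<^sup>*\<^sup>* (start D, three ?n ts) e \<and> fst e = accept D)"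
    unfolding accepts_def seq_second[OF assms(5), symmetric]
    by (rule det_run_reach_final[OF run])
      (use step_not_accept[OF wf_seq[OF assms(1-5)]] in auto)
  assume t: "\<And>l e. (step D K ^^ l) (start D, three ?n ts) e \<Longrightarrow> l \<le> t"
  show "halts_within (seq T D) K x (m + t)"
    unfolding halts_within_def
    using det_run_halts[OF run, of t] t seq_relpowp_second[OF assms(5)] by fastforce
qed

text \<open>Composition needs three tapes, and \<open>D\<close> may have only one; moreover the last
  tape of the transducer may carry leftovers. The second added tape takes these, and the first
  stands in for tape 1 when \<open>D\<close> has no such tape.\<close>

definition add_idle :: "machine \<Rightarrow> machine" where
  "add_idle D = D\<lparr>tapes := tapes D + 2,
     trans := (\<lambda>(q, rs, q', as). (q, rs @ [Blank, Blank], q', as @ [(Blank, Stay), (Blank, Stay)])) ` trans D\<rparr>"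

lemma add_idle_simps [simp]:
  "tapes (add_idle D) = tapes D + 2" "start (add_idle D) = start D"
  "accept (add_idle D) = accept D" "orac (add_idle D) = orac D"
  by (simp_all add: add_idle_def)

lemma add_idle_trans:
  "(q, rs', q', as') \<in> trans (add_idle D) \<longleftrightarrow> (\<exists>rs as. (q, rs, q', as) \<in> trans D \<and>
     rs' = rs @ [Blank, Blank] \<and> as' = as @ [(Blank, Stay), (Blank, Stay)])"
  by (force simp: add_idle_def)

lemma wf_add_idle: "wf_machine D \<Longrightarrow> wf_machine (add_idle D)"
proof -
  assume D: "wf_machine D"
  note * = wf_machineD[OF D]
  have "finite (trans (add_idle D))" using *(1) by (simp add: add_idle_def)
  then show ?thesis using *(2-5) unfolding wf_machine_def by (fastforce simp: add_idle_trans)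
qed

lemma deterministic_add_idle: "deterministic D \<Longrightarrow> deterministic (add_idle D)"
  unfolding deterministic_def add_idle_trans by (metis append_same_eq)

lemma add_idle_step:
  assumes "wf_machine D" "length ts = tapes D" "scanned u = Blank" "scanned v = Blank"
  shows "step (add_idle D) K (q, ts @ [u, v]) x \<longleftrightarrow>
    (\<exists>q' ts'. step D K (q, ts) (q', ts') \<and> x = (q', ts' @ [u, v]))"
proof -
  have idle: "write_move (Blank, Stay) t = t" if "scanned t = Blank" for t
    using that by (cases t) (simp add: fun_upd_idem)
  have l: "length as = length ts" if "(q, rs, q', as) \<in> trans D" for q rs q' as
    using wf_machineD(3)[OF assms(1) that] assms(2) by simp
  have 1: "(q, map scanned (ts @ [u, v]), p', as') \<in> trans (add_idle D) \<longleftrightarrow>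
     (\<exists>as. (q, map scanned ts, p', as) \<in> trans D \<and> as' = as @ [(Blank, Stay), (Blank, Stay)])" for p' as'
    unfolding add_idle_trans using assms(3,4) by auto
  have 2: "map2 write_move (as @ [(Blank, Stay), (Blank, Stay)]) (ts @ [u, v]) =
      map2 write_move as ts @ [u, v]" if "length as = length ts" for as
    using that idle assms(3,4) by simp
  have 3: "reply K (ts @ [u, v]) y n = reply K ts y n" if "orac D = Some (q, y, n)" for y n
    using wf_machineD(4)[OF assms(1) that] assms(2) by (simp add: reply_def nth_append)
  show ?thesis
    unfolding step_iff 1 add_idle_simps using 2 3 l by fastforce
qed

lemma add_idle_relpowp:
  assumes "wf_machine D" "length ts = tapes D" "scanned u = Blank" "scanned v = Blank"
  shows "(step (add_idle D) K ^^ l) (q, ts @ [u, v]) x \<longleftrightarrow>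
    (\<exists>q' ts'. (step D K ^^ l) (q, ts) (q', ts') \<and> x = (q', ts' @ [u, v]))"
proof (induction l arbitrary: x)
  case (Suc l)
  have len: "length ts' = tapes D" if "(step D K ^^ l) (q, ts) (q', ts')" for l q' ts'
    using that
  proof (induction l arbitrary: q' ts')
    case (Suc l)
    then obtain q1 ts1 where "(step D K ^^ l) (q, ts) (q1, ts1)" "step D K (q1, ts1) (q', ts')"
      by (auto simp: relcompp_apply)
    then show ?case using Suc.IH step_length[OF assms(1)] by fastforce
  qed (use assms(2) in simp)
  have "(step (add_idle D) K ^^ Suc l) (q, ts @ [u, v]) x \<longleftrightarrow>
     (\<exists>q' ts'. (step D K ^^ l) (q, ts) (q', ts') \<and> step (add_idle D) K (q', ts' @ [u, v]) x)"
    using Suc.IH by (auto simp: relcompp_apply)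
  also have "\<dots> \<longleftrightarrow> (\<exists>q' ts'. (step D K ^^ l) (q, ts) (q', ts') \<and>
      (\<exists>q2 ts2. step D K (q', ts') (q2, ts2) \<and> x = (q2, ts2 @ [u, v])))"
    using add_idle_step[OF assms(1) len assms(3,4)] by blast
  finally show ?case by (auto simp: relcompp_apply)
qed auto

section \<open>Polynomial-time reductions\<close>

lemma poly_nat_mono: "m \<le> n \<Longrightarrow> poly p m \<le> poly (p :: nat poly) n"
  by (induction p) (auto intro: add_mono mult_mono)

text \<open>Tape 1 must be handed over blank because it may become a tape of the next machine. The
  last tape becomes an idle tape, so it is enough that its head scans a blank. The polynomial
  \<open>r\<close> is needed to bound the time of a machine run on the output.\<close>

definition transduces :: "machine \<Rightarrow> nat set \<Rightarrow> (bool list \<Rightarrow> bool list) \<Rightarrow> bool" where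
  "transduces T K f \<longleftrightarrow> wf_machine T \<and> deterministic T \<and> tapes T = 3 \<and>
    (\<exists>p r :: nat poly. \<forall>x. length (f x) \<le> poly r (length x) \<and>
       (\<exists>m \<le> poly p (length x). \<exists>c. scanned c = Blank \<and>
          (step T K ^^ m) (start T, [input_tape x, blank_tape, blank_tape])
            (accept T, [input_tape (f x), blank_tape, c])))"

text \<open>Closure under many-one reductions that may themselves consult \<open>K\<close>. The time
  bound is \<open>p\<close> for the transducer plus \<open>s\<close> at the length bound
  \<open>r\<close>, by monotonicity of polynomials with natural coefficients.\<close>

lemma P_oracle_vimage:
  assumes "transduces T K f" "wf_machine D" "deterministic D" "poly_time D K"
    "orac T = None \<or> orac D = None"
  shows "f -` language D K \<in> P_oracle K"
proof -
  let ?D = "add_idle D" and ?M = "seq T (add_idle D)"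
  from assms(1) obtain p r :: "nat poly" where T: "wf_machine T" "deterministic T" "tapes T = 3"
    and pr: "\<And>x. length (f x) \<le> poly r (length x) \<and> (\<exists>m \<le> poly p (length x). \<exists>c. scanned c = Blank \<and>
          (step T K ^^ m) (start T, [input_tape x, blank_tape, blank_tape])
            (accept T, [input_tape (f x), blank_tape, c]))"
    unfolding transduces_def by blast
  from assms(4) obtain s :: "nat poly" where s: "\<And>x. halts_within D K x (poly s (length x))"
    unfolding poly_time_def by blast
  have t1: "1 \<le> tapes D" using wf_machineD[OF assms(2)] by blast
  have D: "wf_machine ?D" "3 \<le> tapes ?D" "orac T = None \<or> orac ?D = None"
    using wf_add_idle[OF assms(2)] assms(5) t1 by auto
  have main: "(accepts ?M K x \<longleftrightarrow> accepts D K (f x)) \<and>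
      halts_within ?M K x (poly (p + pcompose s r) (length x))" for x
  proof -
    obtain m c where m: "m \<le> poly p (length x)" and c: "scanned c = Blank"
      and run: "(step T K ^^ m) (start T, [input_tape x, blank_tape, blank_tape])
            (accept T, [input_tape (f x), blank_tape, c])" using pr[of x] by blast
    let ?c = "(start D, three (tapes ?D - 3) [input_tape (f x), blank_tape, c])"
    have dr: "det_run (step T K) m (start T, [input_tape x, blank_tape, blank_tape])
       (accept T, [input_tape (f x), blank_tape, c])"
      by (rule relpowp_det_run[OF run step_deterministic[OF T(1,2)]])
    \<comment> \<open>If \<open>D\<close> has a single tape, tape 1 of the composite is the first
      idle tape; otherwise it belongs to \<open>D\<close>. Both are blank here, so one splitting of
      the list covers both cases.\<close>
    have shape: "?c = (start D, snd (initial D (f x)) @ [blank_tape, c])"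
      using t1 by (simp add: three_def initial_def replicate_append_same[symmetric])
    have bl: "scanned blank_tape = Blank" by (simp add: blank_tape_def)
    have len: "length (snd (initial D (f x))) = tapes D" using t1 by (simp add: initial_def)
    have pow: "(step ?D K ^^ l) ?c e \<longleftrightarrow>
       (\<exists>q' ts'. (step D K ^^ l) (initial D (f x)) (q', ts') \<and> e = (q', ts' @ [blank_tape, c]))" for l e
      unfolding shape add_idle_relpowp[OF assms(2) len bl c] by (simp add: initial_def)
    note beh = seq_behaviour[OF T(1) D(1) T(3) D(2,3) dr, unfolded add_idle_simps(2,3)]
    have "accepts ?M K x \<longleftrightarrow> (\<exists>e. (step ?D K)\<^sup>*\<^sup>* ?c e \<and> fst e = accept D)"
      using beh(1) by simp
    also have "\<dots> \<longleftrightarrow> accepts D K (f x)"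
      unfolding accepts_def rtranclp_power pow by fastforce
    finally have "accepts ?M K x \<longleftrightarrow> accepts D K (f x)" .
    moreover have "halts_within ?M K x (m + poly s (length (f x)))"
    proof (rule beh(2))
      fix l e assume "(step ?D K ^^ l) ?c e"
      then show "l \<le> poly s (length (f x))" using s[of "f x"] unfolding pow halts_within_def by blast
    qed
    moreover have "poly s (length (f x)) \<le> poly s (poly r (length x))"
      using pr[of x] poly_nat_mono by blast
    then have "m + poly s (length (f x)) \<le> poly (p + pcompose s r) (length x)"
      using m by (simp add: poly_pcompose)
    ultimately show ?thesis unfolding halts_within_def using le_trans by blast
  qed
  then have "f -` language D K = language ?M K" by (auto simp: language_def)
  moreover have "poly_time ?M K" using main unfolding poly_time_def by blast
  moreover have "wf_machine ?M" by (rule wf_seq[OF T(1) D(1) T(3) D(2,3)])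
  moreover have "deterministic ?M"
    by (rule deterministic_seq[OF T(1,2) deterministic_add_idle[OF assms(3)] T(3)])
  ultimately show ?thesis unfolding P_oracle_def by blast
qed

lemma P_oracle_vimage_ordinary:
  assumes "transduces T K f" "ordinary T" "L \<in> P_oracle K"
  shows "f -` L \<in> P_oracle K"
  using assms P_oracle_vimage unfolding P_oracle_def ordinary_def by blast

section \<open>Three-tape machines given by transition tables\<close>

type_synonym table = "((nat \<times> symbol list) \<times> nat \<times> (symbol \<times> move) list) list"

text \<open>Going through \<open>map_of\<close> gives each key at most one entry, which makes the
  machine deterministic by construction.\<close>

definition table_machine :: "table \<Rightarrow> nat \<Rightarrow> (nat \<times> nat \<times> nat) option \<Rightarrow> machine" where
  "table_machine xs n oc = \<lparr>tapes = 3, trans = {(q, rs, q', as). map_of xs (q, rs) = Some (q', as)},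
     start = 0, accept = n, orac = oc\<rparr>"

lemma table_machine_simps [simp]:
  "tapes (table_machine xs n oc) = 3" "start (table_machine xs n oc) = 0"
  "accept (table_machine xs n oc) = n" "orac (table_machine xs n oc) = oc"
  by (simp_all add: table_machine_def)

lemma deterministic_table_machine: "deterministic (table_machine xs n oc)"
  by (simp add: table_machine_def deterministic_def)

lemma wf_table_machine:
  assumes "\<forall>((q, rs), q', as) \<in> set xs. length rs = 3 \<and> length as = 3 \<and> q \<noteq> n \<and> (\<forall>y m. oc \<noteq> Some (q, y, m))"
    and "\<forall>y m. oc \<noteq> Some (n, y, m)"
  shows "wf_machine (table_machine xs n oc)"
proof -
  have "trans (table_machine xs n oc) \<subseteq> (\<lambda>((q, rs), q', as). (q, rs, q', as)) ` set xs"
    by (force simp: table_machine_def dest: map_of_SomeD)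
  then have "finite (trans (table_machine xs n oc))" using finite_surj by blast
  moreover have "length rs = 3 \<and> length as = 3 \<and> q \<noteq> n \<and> (\<forall>y m. oc \<noteq> Some (q, y, m))"
    if "(q, rs, q', as) \<in> trans (table_machine xs n oc)" for q rs q' as
    using that assms(1) by (fastforce simp: table_machine_def dest!: map_of_SomeD)
  ultimately show ?thesis unfolding wf_machine_def using assms(2) by fastforce
qed

text \<open>The new tapes and head positions are variables tied by equational premises, so that the
  rule applies to a target configuration in whatever form it is stated.\<close>

lemma table_step:
  assumes "map_of xs (q, [s, t, r]) = Some (q', [(u, l), (v, m), (w, n)])"
    and "a i = s" "b j = t" "c k = r"
    and "a(i := u) = a'" "b(j := v) = b'" "c(k := w) = c'" "shift l i = i'" "shift m j = j'" "shift n k = k'"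
  shows "step (table_machine xs acc oc) K (q, [(a, i), (b, j), (c, k)]) (q', [(a', i'), (b', j'), (c', k')])"
  using assms by (auto simp: step_iff table_machine_def)

lemma table_query:
  assumes "oc = Some (q, y, n)"
  shows "step (table_machine xs acc oc) K (q, ts) (reply K ts y n, ts)"
  using assms by (simp add: step_iff)

lemma relpowp_loop:
  fixes R :: "'c \<Rightarrow> 'c \<Rightarrow> bool"
  assumes "\<And>i. i < n \<Longrightarrow> (R ^^ m) (c i) (c (Suc i))"
  shows "(R ^^ (n * m)) (c 0) (c n)"
  using assms
proof (induction n)
  case (Suc n)
  then have "(R ^^ (n * m + m)) (c 0) (c (Suc n))"
    by (metis lessI less_SucI relcomppI relpowp_add)
  then show ?case by (simp add: add.commute)
qed simp

lemma relpowp_loop1: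
  fixes R :: "'c \<Rightarrow> 'c \<Rightarrow> bool"
  assumes "\<And>i. i < n \<Longrightarrow> R (c i) (c (Suc i))"
  shows "(R ^^ n) (c 0) (c n)"
  using relpowp_loop[where n = n and R = R and m = 1 and c = c] assms by (simp only: relpowp_1 mult_1_right)

lemma relpowp_trans: "((R :: 'c \<Rightarrow> 'c \<Rightarrow> bool) ^^ m) c d \<Longrightarrow> (R ^^ n) d e \<Longrightarrow> (R ^^ (m + n)) c e"
  by (metis relcomppI relpowp_add)

lemma relpowp_single: "(R :: 'c \<Rightarrow> 'c \<Rightarrow> bool) c d \<Longrightarrow> (R ^^ 1) c d"
  by (simp only: relpowp_1)

section \<open>Tape contents: words and unary marks\<close>

definition bits :: "bool list \<Rightarrow> int \<Rightarrow> symbol" where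
  "bits w = (\<lambda>i. if 0 \<le> i \<and> i < int (length w) then Bit (w ! nat i) else Blank)"

definition marks :: "nat \<Rightarrow> int \<Rightarrow> symbol" where
  "marks n = (\<lambda>i. if 0 \<le> i \<and> i < int n then Aux 0 else Blank)"

lemma input_tape_bits: "input_tape w = (bits w, 0)"
  by (simp add: input_tape_def bits_def)

lemma blank_tape_marks: "blank_tape = (marks 0, 0)"
  by (auto simp: blank_tape_def marks_def)

lemma bits_nth [simp]: "i < length w \<Longrightarrow> bits w (int i) = Bit (w ! i)"
  by (simp add: bits_def)

lemma bits_idem [simp]: "i < length w \<Longrightarrow> (bits w)(int i := Bit (w ! i)) = bits w"
  by (rule fun_upd_idem) simp

lemma bits_outside [simp]: "bits w (int (length w)) = Blank" "i < 0 \<Longrightarrow> bits w i = Blank"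
  by (simp_all add: bits_def)

lemma bits_append: "(bits w)(int (length w) := Bit b) = bits (w @ [b])"
  by (auto simp: bits_def nth_append fun_eq_iff nat_less_iff)

lemma marks_outside [simp]: "int n \<le> i \<Longrightarrow> marks n i = Blank" "i < 0 \<Longrightarrow> marks n i = Blank"
  by (simp_all add: marks_def)

lemma marks_inside [simp]: "0 \<le> i \<Longrightarrow> i < int n \<Longrightarrow> marks n i = Aux 0"
  by (simp add: marks_def)

lemma marks_idem [simp]: "0 \<le> i \<Longrightarrow> i < int n \<Longrightarrow> (marks n)(i := Aux 0) = marks n"
  by (rule fun_upd_idem) simp

lemma marks_0 [simp]: "marks 0 i = Blank"
  by (simp add: marks_def)

lemma marks_Suc: "(marks n)(int n := Aux 0) = marks (Suc n)"
  by (auto simp: marks_def fun_eq_iff)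

lemma marks_erase: "(marks (Suc n))(int n := Blank) = marks n"
  by (auto simp: marks_def fun_eq_iff)

section \<open>Padding the input and tabulating a tally oracle\<close>

abbreviation "bit_list \<equiv> [Bit False, Bit True]"

text \<open>One step for each of the \<open>l\<close> cells to the left, and one to turn on the
  blank at -1. The other two heads may move only in the turning step. The head need not start at the
  end of \<open>w\<close>, as happens just after a bit has been appended.\<close>

lemma bits_rewind:
  assumes "\<And>b. map_of xs (q, [Bit b, s, t]) = Some (q, [(Bit b, Left), (s, Stay), (t, Stay)])"
    and "map_of xs (q, [Blank, s, t]) = Some (q', [(Blank, Right), (s, m), (t, n)])"
    and "f i = s" "g j = t" "l \<le> length w"
  shows "(step (table_machine xs acc oc) K ^^ Suc l)
    (q, [(bits w, int l - 1), (f, i), (g, j)]) (q', [(bits w, 0), (f, shift m i), (g, shift n j)])"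
proof -
  have "(step (table_machine xs acc oc) K ^^ l) (q, [(bits w, int l - 1 - int 0), (f, i), (g, j)])
      (q, [(bits w, int l - 1 - int l), (f, i), (g, j)])"
  proof (rule relpowp_loop1[where c = "\<lambda>k. (q, [(bits w, int l - 1 - int k), (f, i), (g, j)])"])
    fix k assume k: "k < l"
    then have e: "int l - 1 - int k = int (l - 1 - k)" by linarith
    have "l - 1 - k < length w" using k assms(5) by linarith
    then have b: "bits w (int (l - 1 - k)) = Bit (w ! (l - 1 - k))" by (rule bits_nth)
    show "step (table_machine xs acc oc) K (q, [(bits w, int l - 1 - int k), (f, i), (g, j)])
      (q, [(bits w, int l - 1 - int (Suc k)), (f, i), (g, j)])"
      unfolding e by (rule table_step[OF assms(1)[of "w ! (l - 1 - k)"]])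
        (use b assms(3,4) k in \<open>simp_all add: fun_upd_idem of_nat_diff\<close>)
  qed
  then have "(step (table_machine xs acc oc) K ^^ l) (q, [(bits w, int l - 1), (f, i), (g, j)])
      (q, [(bits w, - 1), (f, i), (g, j)])" by simp
  moreover have "step (table_machine xs acc oc) K (q, [(bits w, - 1), (f, i), (g, j)])
      (q', [(bits w, 0), (f, shift m i), (g, shift n j)])"
    by (rule table_step[OF assms(2)]) (use assms(3,4) in \<open>simp_all add: fun_upd_idem\<close>)
  ultimately show ?thesis by (rule relpowp_Suc_I)
qed

lemma transduces_tableI:
  fixes p r :: "nat poly"
  assumes "T = table_machine xs n oc" "wf_machine T"
    and "\<And>x. length (f x) \<le> poly r (length x)"
    and "\<And>x. \<exists>m \<le> poly p (length x). \<exists>c. scanned c = Blank \<and>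
      (step T K ^^ m) (0, [(bits x, 0), (marks 0, 0), (marks 0, 0)]) (n, [(bits (f x), 0), (marks 0, 0), c])"
  shows "transduces T K f"
proof -
  have "deterministic T" "tapes T = 3" using assms(1) deterministic_table_machine by auto
  moreover have "\<exists>m \<le> poly p (length x). \<exists>c. scanned c = Blank \<and>
      (step T K ^^ m) (start T, [input_tape x, blank_tape, blank_tape])
        (accept T, [input_tape (f x), blank_tape, c])" for x
    using assms(4)[of x] unfolding input_tape_bits blank_tape_marks assms(1) by simp
  ultimately show ?thesis unfolding transduces_def using assms(2,3) by blast
qed

text \<open>The appended 1 is an end marker: it separates the input from the zeros of the padding,
  so that the padding can be removed again.\<close>

definition append_one_table :: table where
  "append_one_table =
     [((0, [b, Blank, Blank]), 0, [(b, Right), (Blank, Stay), (Blank, Stay)]). b \<leftarrow> bit_list] @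
     [((0, [Blank, Blank, Blank]), 1, [(Bit True, Left), (Blank, Stay), (Blank, Stay)]),
      ((1, [Blank, Blank, Blank]), 2, [(Blank, Right), (Blank, Stay), (Blank, Stay)])] @
     [((1, [b, Blank, Blank]), 1, [(b, Left), (Blank, Stay), (Blank, Stay)]). b \<leftarrow> bit_list]"

lemma append_one_lookup:
  "map_of append_one_table (0, [Bit b, Blank, Blank]) = Some (0, [(Bit b, Right), (Blank, Stay), (Blank, Stay)])"
  "map_of append_one_table (0, [Blank, Blank, Blank]) = Some (1, [(Bit True, Left), (Blank, Stay), (Blank, Stay)])"
  "map_of append_one_table (1, [Blank, Blank, Blank]) = Some (2, [(Blank, Right), (Blank, Stay), (Blank, Stay)])"
  "map_of append_one_table (1, [Bit b, Blank, Blank]) = Some (1, [(Bit b, Left), (Blank, Stay), (Blank, Stay)])"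
  by (cases b; simp add: append_one_table_def)+

definition append_one :: machine where
  "append_one = table_machine append_one_table 2 None"

lemma transduces_append_one: "transduces append_one K (\<lambda>x. x @ [True])"
proof -
  have wf: "wf_machine append_one"
    unfolding append_one_def by (rule wf_table_machine) (auto simp: append_one_table_def)
  note [simp] = append_one_lookup
  let ?R = "step append_one K"
  have run: "(?R ^^ (length x + (1 + Suc (length x))))
      (0, [(bits x, 0), (marks 0, 0), (marks 0, 0)]) (2, [(bits (x @ [True]), 0), (marks 0, 0), (marks 0, 0)])" for x
  proof (intro relpowp_trans)
    have "(?R ^^ length x) (0, [(bits x, int 0), (marks 0, 0), (marks 0, 0)])
        (0, [(bits x, int (length x)), (marks 0, 0), (marks 0, 0)])"
      unfolding append_one_def
      by (rule relpowp_loop1[where c = "\<lambda>i. (0, [(bits x, int i), (marks 0, 0), (marks 0, 0)])"],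
          rule table_step[OF append_one_lookup(1)]) (simp_all add: fun_upd_idem)+
    then show "(?R ^^ length x) (0, [(bits x, 0), (marks 0, 0), (marks 0, 0)])
        (0, [(bits x, int (length x)), (marks 0, 0), (marks 0, 0)])" by simp
    show "(?R ^^ 1) (0, [(bits x, int (length x)), (marks 0, 0), (marks 0, 0)])
        (1, [(bits (x @ [True]), int (length x) - 1), (marks 0, 0), (marks 0, 0)])"
      unfolding append_one_def
      by (rule relpowp_single, rule table_step[OF append_one_lookup(2)])
        (simp_all add: fun_upd_idem bits_append)
    show "(?R ^^ Suc (length x)) (1, [(bits (x @ [True]), int (length x) - 1), (marks 0, 0), (marks 0, 0)])
        (2, [(bits (x @ [True]), 0), (marks 0, 0), (marks 0, 0)])"
      unfolding append_one_def
      using bits_rewind[OF append_one_lookup(4,3), where w = "x @ [True]" and l = "length x"] by simp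
  qed
  show ?thesis
  proof (rule transduces_tableI[OF append_one_def wf])
    show "length (x @ [True]) \<le> poly [:1, 1:] (length x)" for x :: "bool list" by simp
    show "\<exists>m \<le> poly [:2, 2:] (length x). \<exists>c. scanned c = Blank \<and>
      (?R ^^ m) (0, [(bits x, 0), (marks 0, 0), (marks 0, 0)]) (2, [(bits (x @ [True]), 0), (marks 0, 0), c])" for x
      using run[of x] by (intro exI[of _ "length x + (1 + Suc (length x))"] conjI exI[of _ "(marks 0, 0)"]) simp_all
  qed
qed

text \<open>Tape 1 and the last tape first receive one mark for each input bit; then, for each mark of tape 1,
  a sweep over the last tape appends one zero for each of its marks.\<close>

definition square_table :: table where
  "square_table =
     [((0, [b, Blank, Blank]), 0, [(b, Right), (Aux 0, Right), (Aux 0, Right)]). b \<leftarrow> bit_list] @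
     [((0, [Blank, Blank, Blank]), 1, [(Blank, Stay), (Blank, Left), (Blank, Left)]),
      ((1, [Blank, Aux 0, Aux 0]), 2, [(Blank, Stay), (Blank, Left), (Aux 0, Stay)])] @
     [((2, [Blank, s, Aux 0]), 2, [(Bit False, Right), (s, Stay), (Aux 0, Left)]). s \<leftarrow> [Blank, Aux 0]] @
     [((2, [Blank, s, Blank]), 3, [(Blank, Stay), (s, Stay), (Blank, Right)]). s \<leftarrow> [Blank, Aux 0]] @
     [((3, [Blank, s, Aux 0]), 3, [(Blank, Stay), (s, Stay), (Aux 0, Right)]). s \<leftarrow> [Blank, Aux 0]] @
     [((3, [Blank, s, Blank]), 1, [(Blank, Stay), (s, Stay), (Blank, Left)]). s \<leftarrow> [Blank, Aux 0]] @
     [((1, [Blank, Blank, s]), 4, [(Blank, Left), (Blank, Right), (s, Right)]). s \<leftarrow> [Blank, Aux 0]] @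
     [((4, [b, Blank, Blank]), 4, [(b, Left), (Blank, Stay), (Blank, Stay)]). b \<leftarrow> bit_list] @
     [((4, [Blank, Blank, Blank]), 5, [(Blank, Right), (Blank, Stay), (Blank, Stay)])]"

lemma square_lookup:
  "map_of square_table (0, [Bit b, Blank, Blank]) = Some (0, [(Bit b, Right), (Aux 0, Right), (Aux 0, Right)])"
  "map_of square_table (0, [Blank, Blank, Blank]) = Some (1, [(Blank, Stay), (Blank, Left), (Blank, Left)])"
  "map_of square_table (1, [Blank, Aux 0, Aux 0]) = Some (2, [(Blank, Stay), (Blank, Left), (Aux 0, Stay)])"
  "s \<in> {Blank, Aux 0} \<Longrightarrow>
    map_of square_table (2, [Blank, s, Aux 0]) = Some (2, [(Bit False, Right), (s, Stay), (Aux 0, Left)])"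
  "s \<in> {Blank, Aux 0} \<Longrightarrow>
    map_of square_table (2, [Blank, s, Blank]) = Some (3, [(Blank, Stay), (s, Stay), (Blank, Right)])"
  "s \<in> {Blank, Aux 0} \<Longrightarrow>
    map_of square_table (3, [Blank, s, Aux 0]) = Some (3, [(Blank, Stay), (s, Stay), (Aux 0, Right)])"
  "s \<in> {Blank, Aux 0} \<Longrightarrow>
    map_of square_table (3, [Blank, s, Blank]) = Some (1, [(Blank, Stay), (s, Stay), (Blank, Left)])"
  "s \<in> {Blank, Aux 0} \<Longrightarrow>
    map_of square_table (1, [Blank, Blank, s]) = Some (4, [(Blank, Left), (Blank, Right), (s, Right)])"
  "map_of square_table (4, [Bit b, Blank, Blank]) = Some (4, [(Bit b, Left), (Blank, Stay), (Blank, Stay)])"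
  "map_of square_table (4, [Blank, Blank, Blank]) = Some (5, [(Blank, Right), (Blank, Stay), (Blank, Stay)])"
  by (cases b; auto simp: square_table_def)+

definition square :: machine where
  "square = table_machine square_table 5 None"

text \<open>The length grows from \<open>n\<close> to \<open>n + n^2\<close>. Iterating this
  constant-size construction outgrows every polynomial.\<close>

definition pad :: "bool list \<Rightarrow> bool list" where
  "pad x = x @ replicate (length x * length x) False"

lemma marks_cell: "marks n i \<in> {Blank, Aux 0}"
  by (simp add: marks_def)

text \<open>One round of the unary multiplication. It uses up a mark of tape 1 in 1 step, writes
  \<open>n\<close> zeros while the last head walks left, turns, walks back in \<open>n\<close>
  steps, and turns again, which makes \<open>2 * n + 3\<close> steps. For the first step the last
  head must stand on a mark, hence \<open>0 < n\<close>.\<close>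

lemma square_sweep:
  fixes x :: "bool list" and j l :: nat
  defines "n \<equiv> length x" and "w \<equiv> \<lambda>l. x @ replicate l False"
  assumes "0 < n"
  shows "(step square K ^^ (2 * n + 3))
    (1, [(bits (w l), int (n + l)), (marks (Suc j), int j), (marks n, int n - 1)])
    (1, [(bits (w (l + n)), int (n + (l + n))), (marks j, int j - 1), (marks n, int n - 1)])"
proof -
  let ?R = "step square K"
  have w: "length (w l) = n + l" for l by (simp add: w_def n_def)
  have out: "bits (w l) (int (n + l)) = Blank" for l using bits_outside(1)[of "w l"] by (simp add: w)
  have app: "(bits (w l))(int (n + l) := Bit False) = bits (w (Suc l))" for l
    using bits_append[of "w l" False] by (simp add: w) (simp add: w_def replicate_append_same)
  have "(?R ^^ (1 + (n + (1 + (n + 1)))))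
    (1, [(bits (w l), int (n + l)), (marks (Suc j), int j), (marks n, int n - 1)])
    (1, [(bits (w (l + n)), int (n + (l + n))), (marks j, int j - 1), (marks n, int n - 1)])"
  proof (intro relpowp_trans)
    show "(?R ^^ 1) (1, [(bits (w l), int (n + l)), (marks (Suc j), int j), (marks n, int n - 1)])
      (2, [(bits (w (l + 0)), int (n + (l + 0))), (marks j, int j - 1), (marks n, int n - 1 - int 0)])"
      unfolding square_def using out[of l] assms(3)
      by (intro relpowp_single table_step[OF square_lookup(3)])
        (simp_all add: fun_upd_idem marks_erase del: of_nat_add)
    show "(?R ^^ n)
      (2, [(bits (w (l + 0)), int (n + (l + 0))), (marks j, int j - 1), (marks n, int n - 1 - int 0)])
      (2, [(bits (w (l + n)), int (n + (l + n))), (marks j, int j - 1), (marks n, int n - 1 - int n)])"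
    proof (rule relpowp_loop1[where c = "\<lambda>i.
        (2, [(bits (w (l + i)), int (n + (l + i))), (marks j, int j - 1), (marks n, int n - 1 - int i)])"])
      fix i assume i: "i < n"
      show "?R (2, [(bits (w (l + i)), int (n + (l + i))), (marks j, int j - 1), (marks n, int n - 1 - int i)])
        (2, [(bits (w (l + Suc i)), int (n + (l + Suc i))), (marks j, int j - 1), (marks n, int n - 1 - int (Suc i))])"
        unfolding square_def using out[of "l + i"] app[of "l + i"] i
        by (intro table_step[OF square_lookup(4)[OF marks_cell[of j "int j - 1"]]])
         (simp_all add: fun_upd_idem del: of_nat_add)
    qed
    show "(?R ^^ 1)
      (2, [(bits (w (l + n)), int (n + (l + n))), (marks j, int j - 1), (marks n, int n - 1 - int n)])
      (3, [(bits (w (l + n)), int (n + (l + n))), (marks j, int j - 1), (marks n, int 0)])"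
      unfolding square_def using out[of "l + n"]
      by (intro relpowp_single table_step[OF square_lookup(5)[OF marks_cell[of j "int j - 1"]]])
         (simp_all add: fun_upd_idem del: of_nat_add)
    show "(?R ^^ n)
      (3, [(bits (w (l + n)), int (n + (l + n))), (marks j, int j - 1), (marks n, int 0)])
      (3, [(bits (w (l + n)), int (n + (l + n))), (marks j, int j - 1), (marks n, int n)])"
      unfolding square_def using out[of "l + n"]
      by (intro relpowp_loop1[where c = "\<lambda>i.
          (3, [(bits (w (l + n)), int (n + (l + n))), (marks j, int j - 1), (marks n, int i)])"]
          table_step[OF square_lookup(6)[OF marks_cell[of j "int j - 1"]]])
        (simp_all add: fun_upd_idem del: of_nat_add)
    show "(?R ^^ 1)
      (3, [(bits (w (l + n)), int (n + (l + n))), (marks j, int j - 1), (marks n, int n)])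
      (1, [(bits (w (l + n)), int (n + (l + n))), (marks j, int j - 1), (marks n, int n - 1)])"
      unfolding square_def using out[of "l + n"]
      by (intro relpowp_single table_step[OF square_lookup(7)[OF marks_cell[of j "int j - 1"]]])
         (simp_all add: fun_upd_idem del: of_nat_add)
  qed
  moreover have "1 + (n + (1 + (n + 1))) = 2 * n + 3" by simp
  ultimately show ?thesis by (simp only:)
qed

lemma transduces_square: "transduces square K pad"
proof -
  have wf: "wf_machine square"
    unfolding square_def by (rule wf_table_machine) (auto simp: square_table_def)
  let ?R = "step square K"
  let ?w = "\<lambda>x l. x @ replicate l False"
  have run: "(?R ^^ (length x + (1 + (length x * (2 * length x + 3) + (1 + Suc (length (pad x)))))))
      (0, [(bits x, 0), (marks 0, 0), (marks 0, 0)])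
      (5, [(bits (pad x), 0), (marks 0, 0), (marks (length x), int (length x))])" for x
  proof (intro relpowp_trans)
    let ?n = "length x"
    have "(?R ^^ ?n) (0, [(bits x, int 0), (marks 0, int 0), (marks 0, int 0)])
        (0, [(bits x, int ?n), (marks ?n, int ?n), (marks ?n, int ?n)])"
      unfolding square_def
      by (rule relpowp_loop1[where c = "\<lambda>i. (0, [(bits x, int i), (marks i, int i), (marks i, int i)])"],
          rule table_step[OF square_lookup(1)]) (simp_all add: marks_Suc)+
    then show "(?R ^^ ?n) (0, [(bits x, 0), (marks 0, 0), (marks 0, 0)])
        (0, [(bits x, int ?n), (marks ?n, int ?n), (marks ?n, int ?n)])" by simp
    show "(?R ^^ 1) (0, [(bits x, int ?n), (marks ?n, int ?n), (marks ?n, int ?n)])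
      (1, [(bits (?w x (0 * ?n)), int (?n + 0 * ?n)), (marks (?n - 0), int (?n - 0) - 1), (marks ?n, int ?n - 1)])"
      unfolding square_def
      by (intro relpowp_single table_step[OF square_lookup(2)]) (simp_all add: fun_upd_idem)
    \<comment> \<open>After \<open>i\<close> rounds \<open>i * ?n\<close> zeros are written and
      \<open>?n - i\<close> marks remain on tape 1. Its head stands on the last remaining mark, or
      on cell -1 when none is left.\<close>
    show "(?R ^^ (?n * (2 * ?n + 3)))
      (1, [(bits (?w x (0 * ?n)), int (?n + 0 * ?n)), (marks (?n - 0), int (?n - 0) - 1), (marks ?n, int ?n - 1)])
      (1, [(bits (?w x (?n * ?n)), int (?n + ?n * ?n)), (marks (?n - ?n), int (?n - ?n) - 1), (marks ?n, int ?n - 1)])"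
    proof (rule relpowp_loop[where c = "\<lambda>i. (1, [(bits (?w x (i * ?n)), int (?n + i * ?n)),
        (marks (?n - i), int (?n - i) - 1), (marks ?n, int ?n - 1)])"])
      fix i assume i: "i < ?n"
      then have e: "Suc (?n - Suc i) = ?n - i" "int (?n - Suc i) = int (?n - i) - 1"
        "Suc i * ?n = i * ?n + ?n" by auto
      show "(?R ^^ (2 * ?n + 3))
        (1, [(bits (?w x (i * ?n)), int (?n + i * ?n)), (marks (?n - i), int (?n - i) - 1), (marks ?n, int ?n - 1)])
        (1, [(bits (?w x (Suc i * ?n)), int (?n + Suc i * ?n)), (marks (?n - Suc i), int (?n - Suc i) - 1), (marks ?n, int ?n - 1)])"
        using square_sweep[of x K "i * ?n" "?n - Suc i"] i unfolding e by fastforce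
    qed
    show "(?R ^^ 1)
      (1, [(bits (?w x (?n * ?n)), int (?n + ?n * ?n)), (marks (?n - ?n), int (?n - ?n) - 1), (marks ?n, int ?n - 1)])
      (4, [(bits (pad x), int (length (pad x)) - 1), (marks 0, 0), (marks ?n, int ?n)])"
      unfolding square_def using bits_outside(1)[of "pad x"]
      by (intro relpowp_single table_step[OF square_lookup(8)[OF marks_cell[of ?n "int ?n - 1"]]])
        (simp_all add: pad_def fun_upd_idem)
    show "(?R ^^ Suc (length (pad x))) (4, [(bits (pad x), int (length (pad x)) - 1), (marks 0, 0), (marks ?n, int ?n)])
      (5, [(bits (pad x), 0), (marks 0, 0), (marks ?n, int ?n)])"
      unfolding square_def using bits_rewind[OF square_lookup(9,10), where w = "pad x" and l = "length (pad x)"]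
      by simp
  qed
  show ?thesis
  proof (rule transduces_tableI[OF square_def wf])
    show "length (pad x) \<le> poly [:0, 1, 1:] (length x)" for x by (simp add: pad_def algebra_simps)
    \<comment> \<open>With \<open>n\<close> the input length, the phases take n, 1, n(2n + 3), 1 and
      n + n^2 + 1 steps. The marks stay on the last tape, whose head rests on the blank behind
      them.\<close>
    show "\<exists>m \<le> poly [:3, 5, 3:] (length x). \<exists>c. scanned c = Blank \<and>
      (?R ^^ m) (0, [(bits x, 0), (marks 0, 0), (marks 0, 0)]) (5, [(bits (pad x), 0), (marks 0, 0), c])" for x
      using run[of x]
      by (intro exI[of _ "length x + (1 + (length x * (2 * length x + 3) + (1 + Suc (length (pad x)))))"]
          conjI exI[of _ "(marks (length x), int (length x))"]) (simp_all add: pad_def algebra_simps)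
  qed
qed

text \<open>Tape 1 receives one mark for each input bit. Overwriting the marks by zeros one at a time produces
  the queries, since a query word ends at the first mark; the answers are appended to the input.\<close>

definition tabulate_table :: table where
  "tabulate_table =
     [((0, [b, Blank, Blank]), 0, [(b, Right), (Aux 0, Right), (Blank, Stay)]). b \<leftarrow> bit_list] @
     [((0, [Blank, Blank, Blank]), 1, [(Blank, Stay), (Blank, Left), (Blank, Stay)]),
      ((1, [Blank, Aux 0, Blank]), 1, [(Blank, Stay), (Aux 0, Left), (Blank, Stay)]),
      ((1, [Blank, Blank, Blank]), 2, [(Blank, Stay), (Blank, Right), (Blank, Stay)]),
      ((2, [Blank, Aux 0, Blank]), 3, [(Blank, Stay), (Aux 0, Stay), (Blank, Stay)]),
      ((4, [Blank, Aux 0, Blank]), 2, [(Bit True, Right), (Bit False, Right), (Blank, Stay)]),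
      ((5, [Blank, Aux 0, Blank]), 2, [(Bit False, Right), (Bit False, Right), (Blank, Stay)]),
      ((2, [Blank, Blank, Blank]), 6, [(Blank, Left), (Blank, Left), (Blank, Stay)])] @
     [((6, [s, Bit False, Blank]), 6, [(s, Stay), (Blank, Left), (Blank, Stay)]). s \<leftarrow> Blank # bit_list] @
     [((6, [s, Blank, Blank]), 7, [(s, Stay), (Blank, Right), (Blank, Stay)]). s \<leftarrow> Blank # bit_list] @
     [((7, [b, Blank, Blank]), 7, [(b, Left), (Blank, Stay), (Blank, Stay)]). b \<leftarrow> bit_list] @
     [((7, [Blank, Blank, Blank]), 8, [(Blank, Right), (Blank, Stay), (Blank, Stay)])]"

lemma tabulate_lookup:
  "map_of tabulate_table (0, [Bit b, Blank, Blank]) = Some (0, [(Bit b, Right), (Aux 0, Right), (Blank, Stay)])"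
  "map_of tabulate_table (0, [Blank, Blank, Blank]) = Some (1, [(Blank, Stay), (Blank, Left), (Blank, Stay)])"
  "map_of tabulate_table (1, [Blank, Aux 0, Blank]) = Some (1, [(Blank, Stay), (Aux 0, Left), (Blank, Stay)])"
  "map_of tabulate_table (1, [Blank, Blank, Blank]) = Some (2, [(Blank, Stay), (Blank, Right), (Blank, Stay)])"
  "map_of tabulate_table (2, [Blank, Aux 0, Blank]) = Some (3, [(Blank, Stay), (Aux 0, Stay), (Blank, Stay)])"
  "map_of tabulate_table (if b then 4 else 5, [Blank, Aux 0, Blank]) =
    Some (2, [(Bit b, Right), (Bit False, Right), (Blank, Stay)])"
  "map_of tabulate_table (2, [Blank, Blank, Blank]) = Some (6, [(Blank, Left), (Blank, Left), (Blank, Stay)])"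
  "s \<in> insert Blank (range Bit) \<Longrightarrow>
    map_of tabulate_table (6, [s, Bit False, Blank]) = Some (6, [(s, Stay), (Blank, Left), (Blank, Stay)])"
  "s \<in> insert Blank (range Bit) \<Longrightarrow>
    map_of tabulate_table (6, [s, Blank, Blank]) = Some (7, [(s, Stay), (Blank, Right), (Blank, Stay)])"
  "map_of tabulate_table (7, [Bit b, Blank, Blank]) = Some (7, [(Bit b, Left), (Blank, Stay), (Blank, Stay)])"
  "map_of tabulate_table (7, [Blank, Blank, Blank]) = Some (8, [(Blank, Right), (Blank, Stay), (Blank, Stay)])"
  by (cases b; force simp: tabulate_table_def UNIV_bool)+

definition tabulate :: machine where
  "tabulate = table_machine tabulate_table 8 (Some (3, 4, 5))"

definition tally :: "nat \<Rightarrow> nat" where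
  "tally i = str_index (replicate i False)"

definition with_table :: "nat set \<Rightarrow> bool list \<Rightarrow> bool list" where
  "with_table K x = x @ map (\<lambda>i. tally i \<in> K) [0..<length x]"

definition part_marks :: "nat \<Rightarrow> nat \<Rightarrow> int \<Rightarrow> symbol" where
  "part_marks n i = (\<lambda>k. if 0 \<le> k \<and> k < int i then Bit False else if 0 \<le> k \<and> k < int n then Aux 0 else Blank)"

lemma part_marks_0: "part_marks n 0 = marks n"
  by (auto simp: part_marks_def marks_def)

lemma part_marks_full: "part_marks n n = bits (replicate n False)"
  by (auto simp: part_marks_def bits_def fun_eq_iff nat_less_iff)

lemma part_marks_Suc: "(part_marks n i)(int i := Bit False) = part_marks n (Suc i)"
  by (auto simp: part_marks_def fun_eq_iff)

lemma part_marks_nth: "i < n \<Longrightarrow> part_marks n i (int i) = Aux 0"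
  by (simp add: part_marks_def)

lemma query_word_part_marks: "i \<le> n \<Longrightarrow> query_word (part_marks n i, h) = replicate i False"
proof -
  assume i: "i \<le> n"
  have "(LEAST m. \<forall>b. part_marks n i (int m) \<noteq> Bit b) = i"
    by (rule Least_equality) (auto simp: part_marks_def not_less[symmetric])
  then show ?thesis
    by (simp add: query_word_def part_marks_def) (simp add: list_eq_iff_nth_eq)
qed

lemma bits_cell: "bits w i \<in> insert Blank (range Bit)"
  by (simp add: bits_def)

lemma tabulate_query:
  assumes "i < n"
  shows "(step tabulate K ^^ 3)
    (2, [(bits w, int (length w)), (part_marks n i, int i), (marks 0, 0)])
    (2, [(bits (w @ [tally i \<in> K]), int (length w) + 1), (part_marks n (Suc i), int (Suc i)), (marks 0, 0)])"
proof -
  let ?R = "step tabulate K"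
  let ?ts = "[(bits w, int (length w)), (part_marks n i, int i), (marks 0, 0)]"
  have "?R (2, ?ts) (3, ?ts)" unfolding tabulate_def
    by (rule table_step[OF tabulate_lookup(5)]) (use assms in \<open>simp_all add: part_marks_nth fun_upd_idem\<close>)
  moreover have "?R (3, ?ts) (if tally i \<in> K then 4 else 5, ?ts)"
    unfolding tabulate_def using table_query[of "Some (3, 4, 5)" 3 4 5 tabulate_table 8 K ?ts] assms
    by (simp add: reply_def query_word_part_marks tally_def)
  moreover have "?R (if tally i \<in> K then 4 else 5, ?ts)
      (2, [(bits (w @ [tally i \<in> K]), int (length w) + 1), (part_marks n (Suc i), int (Suc i)), (marks 0, 0)])"
    unfolding tabulate_def
    by (rule table_step[OF tabulate_lookup(6)])
      (use assms in \<open>simp_all add: part_marks_nth fun_upd_idem bits_append part_marks_Suc\<close>)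
  ultimately have "(?R ^^ Suc (Suc (Suc 0))) (2, ?ts)
      (2, [(bits (w @ [tally i \<in> K]), int (length w) + 1), (part_marks n (Suc i), int (Suc i)), (marks 0, 0)])"
    by (intro relpowp_Suc_I[where y = "(if tally i \<in> K then 4 else 5, ?ts)"] relpowp_Suc_I[where y = "(3, ?ts)"]
       relpowp_Suc_I[where y = "(2, ?ts)"]) auto
  then show ?thesis by (simp only: numeral_3_eq_3)
qed

lemma transduces_tabulate: "transduces tabulate K (with_table K)"
proof -
  have wf: "wf_machine tabulate"
    unfolding tabulate_def by (rule wf_table_machine) (auto simp: tabulate_table_def)
  let ?R = "step tabulate K"
  let ?w = "\<lambda>x l. x @ map (\<lambda>i. tally i \<in> K) [0..<l]"
  have run: "(?R ^^ (length x + (1 + (length x + (1 + (length x * 3 + (1 + (length x + (1 +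
          Suc (length (with_table K x)))))))))))
      (0, [(bits x, 0), (marks 0, 0), (marks 0, 0)])
      (8, [(bits (with_table K x), 0), (marks 0, 0), (marks 0, 0)])" for x
  proof (intro relpowp_trans)
    let ?n = "length x" and ?z = "with_table K x"
    have "(?R ^^ ?n) (0, [(bits x, int 0), (marks 0, int 0), (marks 0, 0)])
        (0, [(bits x, int ?n), (marks ?n, int ?n), (marks 0, 0)])"
      unfolding tabulate_def
      by (rule relpowp_loop1[where c = "\<lambda>i. (0, [(bits x, int i), (marks i, int i), (marks 0, 0)])"],
          rule table_step[OF tabulate_lookup(1)]) (simp_all add: marks_Suc fun_upd_idem)+
    then show "(?R ^^ ?n) (0, [(bits x, 0), (marks 0, 0), (marks 0, 0)])
        (0, [(bits x, int ?n), (marks ?n, int ?n), (marks 0, 0)])" by simp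
    show "(?R ^^ 1) (0, [(bits x, int ?n), (marks ?n, int ?n), (marks 0, 0)])
        (1, [(bits x, int ?n), (marks ?n, int ?n - 1 - int 0), (marks 0, 0)])"
      unfolding tabulate_def
      by (intro relpowp_single table_step[OF tabulate_lookup(2)]) (simp_all add: fun_upd_idem)
    show "(?R ^^ ?n) (1, [(bits x, int ?n), (marks ?n, int ?n - 1 - int 0), (marks 0, 0)])
        (1, [(bits x, int ?n), (marks ?n, int ?n - 1 - int ?n), (marks 0, 0)])"
      unfolding tabulate_def
      by (rule relpowp_loop1[where c = "\<lambda>i. (1, [(bits x, int ?n), (marks ?n, int ?n - 1 - int i), (marks 0, 0)])"],
          rule table_step[OF tabulate_lookup(3)]) (simp_all add: fun_upd_idem)
    show "(?R ^^ 1) (1, [(bits x, int ?n), (marks ?n, int ?n - 1 - int ?n), (marks 0, 0)])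
        (2, [(bits (?w x 0), int ?n + int 0), (part_marks ?n 0, int 0), (marks 0, 0)])"
      unfolding tabulate_def
      by (intro relpowp_single table_step[OF tabulate_lookup(4)]) (simp_all add: fun_upd_idem part_marks_0)
    show "(?R ^^ (?n * 3))
        (2, [(bits (?w x 0), int ?n + int 0), (part_marks ?n 0, int 0), (marks 0, 0)])
        (2, [(bits (?w x ?n), int ?n + int ?n), (part_marks ?n ?n, int ?n), (marks 0, 0)])"
    proof (rule relpowp_loop[where c = "\<lambda>i.
          (2, [(bits (?w x i), int ?n + int i), (part_marks ?n i, int i), (marks 0, 0)])"])
      fix i assume "i < ?n"
      from tabulate_query[OF this, of K "?w x i"]
      show "(?R ^^ 3) (2, [(bits (?w x i), int ?n + int i), (part_marks ?n i, int i), (marks 0, 0)])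
        (2, [(bits (?w x (Suc i)), int ?n + int (Suc i)), (part_marks ?n (Suc i), int (Suc i)), (marks 0, 0)])"
        by (simp add: algebra_simps)
    qed
    show "(?R ^^ 1)
        (2, [(bits (?w x ?n), int ?n + int ?n), (part_marks ?n ?n, int ?n), (marks 0, 0)])
        (6, [(bits ?z, int (length ?z) - 1), (bits (replicate (?n - 0) False), int (?n - 0) - 1), (marks 0, 0)])"
      unfolding tabulate_def part_marks_full
      using bits_outside(1)[of ?z] bits_outside(1)[of "replicate ?n False"]
      by (intro relpowp_single table_step[OF tabulate_lookup(7)]) (simp_all add: with_table_def fun_upd_idem)
    \<comment> \<open>The last query left only zeros on tape 1. They are erased, since a transducer
      has to return this tape blank.\<close>
    show "(?R ^^ ?n)
        (6, [(bits ?z, int (length ?z) - 1), (bits (replicate (?n - 0) False), int (?n - 0) - 1), (marks 0, 0)])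
        (6, [(bits ?z, int (length ?z) - 1), (bits (replicate (?n - ?n) False), int (?n - ?n) - 1), (marks 0, 0)])"
    proof (rule relpowp_loop1[where c = "\<lambda>i. (6, [(bits ?z, int (length ?z) - 1),
         (bits (replicate (?n - i) False), int (?n - i) - 1), (marks 0, 0)])"])
      fix i assume "i < ?n"
      then obtain k where k: "?n - i = Suc k" "?n - Suc i = k" by (metis Suc_diff_Suc)
      have "(bits (replicate (Suc k) False))(int k := Blank) = bits (replicate k False)"
        by (auto simp: bits_def fun_eq_iff nat_less_iff simp del: replicate_Suc)
      then show "?R (6, [(bits ?z, int (length ?z) - 1), (bits (replicate (?n - i) False), int (?n - i) - 1), (marks 0, 0)])
        (6, [(bits ?z, int (length ?z) - 1), (bits (replicate (?n - Suc i) False), int (?n - Suc i) - 1), (marks 0, 0)])"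
        unfolding tabulate_def k
        by (intro table_step[OF tabulate_lookup(8)[OF bits_cell[of ?z "int (length ?z) - 1"]]])
          (auto simp: fun_upd_idem bits_def simp del: replicate_Suc)
    qed
    show "(?R ^^ 1)
        (6, [(bits ?z, int (length ?z) - 1), (bits (replicate (?n - ?n) False), int (?n - ?n) - 1), (marks 0, 0)])
        (7, [(bits ?z, int (length ?z) - 1), (marks 0, 0), (marks 0, 0)])"
      unfolding tabulate_def
      by (intro relpowp_single table_step[OF tabulate_lookup(9)[OF bits_cell[of ?z "int (length ?z) - 1"]]])
        (auto simp: fun_upd_idem bits_def marks_def)
    show "(?R ^^ Suc (length ?z)) (7, [(bits ?z, int (length ?z) - 1), (marks 0, 0), (marks 0, 0)])
      (8, [(bits ?z, 0), (marks 0, 0), (marks 0, 0)])"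
      unfolding tabulate_def using bits_rewind[OF tabulate_lookup(10,11), where w = ?z and l = "length ?z"]
      by simp
  qed
  show ?thesis
  proof (rule transduces_tableI[OF tabulate_def wf])
    show "length (with_table K x) \<le> poly [:0, 2:] (length x)" for x by (simp add: with_table_def)
    show "\<exists>m \<le> poly [:5, 8:] (length x). \<exists>c. scanned c = Blank \<and>
      (?R ^^ m) (0, [(bits x, 0), (marks 0, 0), (marks 0, 0)]) (8, [(bits (with_table K x), 0), (marks 0, 0), c])" for x
      using run[of x]
      by (intro exI[of _ "length x + (1 + (length x + (1 + (length x * 3 + (1 + (length x + (1 +
          Suc (length (with_table K x)))))))))"] conjI exI[of _ "(marks 0, 0)"]) (simp_all add: with_table_def)
  qed
qed

section \<open>Decoding a padded input and a table\<close>

text \<open>This provides \<open>to_nat\<close> on the triples below, so that a composite cell can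
  be coded by a single \<open>Aux\<close> symbol.\<close>

instance symbol :: countable
  by countable_datatype

type_synonym cell = "symbol \<times> bool option \<times> bool"

text \<open>A cell of the simulated query tape: its symbol, the oracle table entry stored there (\<open>None\<close> off
  the table), and whether the head of the simulated machine is parked there. Untouched cells off the
  table have to be coded by \<open>Blank\<close>.\<close>

definition cell :: "cell \<Rightarrow> symbol" where
  "cell c = (if c = (Blank, None, False) then Blank else Aux (to_nat c))"

lemma cell_eq_iff [simp]: "cell c = cell d \<longleftrightarrow> c = d"
  by (auto simp: cell_def)

lemma cell_blank [simp]: "cell (Blank, None, False) = Blank"
  by (simp add: cell_def)

text \<open>The input is read with the other two heads at half speed, which locates its middle; on the way back
  the second half moves to tape 1 as the oracle table. Then the padding is stripped from the first half.
  The marks left on the last tape serve the simulation as a clock.\<close>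

definition decode_table :: table where
  "decode_table =
     [((0, [b, Blank, Blank]), 1, [(b, Right), (Blank, Stay), (Blank, Stay)]). b \<leftarrow> bit_list] @
     [((1, [b, Blank, Blank]), 0, [(b, Right), (Blank, Right), (Aux 0, Right)]). b \<leftarrow> bit_list] @
     [((0, [Blank, Blank, Blank]), 2, [(Blank, Left), (Blank, Left), (Blank, Left)]),
      ((1, [Blank, Blank, Blank]), 2, [(Blank, Left), (Blank, Left), (Blank, Left)])] @
     [((2, [Bit b, Blank, Aux 0]), 2, [(Blank, Left), (cell (Blank, Some b, False), Left), (Aux 0, Left)]). b \<leftarrow> [False, True]] @
     [((2, [s, Blank, Blank]), 3, [(s, Stay), (Blank, Stay), (Blank, Stay)]). s \<leftarrow> Blank # bit_list] @
     [((3, [Bit False, Blank, Blank]), 3, [(Blank, Left), (Blank, Stay), (Blank, Stay)]),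
      ((3, [Bit True, Blank, Blank]), 4, [(Blank, Left), (Blank, Stay), (Blank, Stay)]),
      ((3, [Blank, Blank, Blank]), 5, [(Blank, Right), (Blank, Right), (Blank, Right)])] @
     [((4, [b, Blank, Blank]), 4, [(b, Left), (Blank, Stay), (Blank, Stay)]). b \<leftarrow> bit_list] @
     [((4, [Blank, Blank, Blank]), 5, [(Blank, Right), (Blank, Right), (Blank, Right)])]"

lemma decode_lookup:
  "map_of decode_table (0, [Bit b, Blank, Blank]) = Some (1, [(Bit b, Right), (Blank, Stay), (Blank, Stay)])"
  "map_of decode_table (1, [Bit b, Blank, Blank]) = Some (0, [(Bit b, Right), (Blank, Right), (Aux 0, Right)])"
  "map_of decode_table (0, [Blank, Blank, Blank]) = Some (2, [(Blank, Left), (Blank, Left), (Blank, Left)])"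
  "map_of decode_table (1, [Blank, Blank, Blank]) = Some (2, [(Blank, Left), (Blank, Left), (Blank, Left)])"
  "map_of decode_table (2, [Bit b, Blank, Aux 0]) =
    Some (2, [(Blank, Left), (cell (Blank, Some b, False), Left), (Aux 0, Left)])"
  "s \<in> insert Blank (range Bit) \<Longrightarrow>
    map_of decode_table (2, [s, Blank, Blank]) = Some (3, [(s, Stay), (Blank, Stay), (Blank, Stay)])"
  "map_of decode_table (3, [Bit False, Blank, Blank]) = Some (3, [(Blank, Left), (Blank, Stay), (Blank, Stay)])"
  "map_of decode_table (3, [Bit True, Blank, Blank]) = Some (4, [(Blank, Left), (Blank, Stay), (Blank, Stay)])"
  "map_of decode_table (3, [Blank, Blank, Blank]) = Some (5, [(Blank, Right), (Blank, Right), (Blank, Right)])"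
  "map_of decode_table (4, [Bit b, Blank, Blank]) = Some (4, [(Bit b, Left), (Blank, Stay), (Blank, Stay)])"
  "map_of decode_table (4, [Blank, Blank, Blank]) = Some (5, [(Blank, Right), (Blank, Right), (Blank, Right)])"
  by (cases b; force simp: decode_table_def UNIV_bool)+

definition decode :: machine where
  "decode = table_machine decode_table 5 None"

lemma wf_decode: "wf_machine decode"
  unfolding decode_def by (rule wf_table_machine) (auto simp: decode_table_def)

text \<open>The inverse of padding: trailing zeros are dropped, then the end marker. A string
  without a 1 is sent to the empty word, which makes the function total on malformed inputs.\<close>

definition strip :: "bool list \<Rightarrow> bool list" where
  "strip y = rev (tl (dropWhile Not (rev y)))"

lemma strip_simps [simp]: "strip [] = []" "strip (y @ [False]) = strip y" "strip (y @ [True]) = y"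
  by (simp_all add: strip_def)

lemma strip_replicate: "strip (x @ True # replicate m False) = x"
  using strip_simps(3)[of x] 
  by (induction m) (simp_all add: replicate_append_same[symmetric] flip: append_Cons append_assoc del: strip_simps(3))

lemma bits_take: "m < length z \<Longrightarrow> (bits (take (Suc m) z))(int m := Blank) = bits (take m z)"
  by (auto simp: bits_def fun_eq_iff nat_less_iff)

text \<open>State 3 erases zeros from the right; the first 1 is erased as well and leads to state 4,
  which only rewinds. A word without a 1 is erased completely and ends directly in state 5.\<close>

lemma strip_run:
  assumes "f (-1) = Blank" "g (-1) = Blank"
  shows "\<exists>m \<le> length y + 1. (step decode K ^^ m) (3, [(bits y, int (length y) - 1), (f, -1), (g, -1)])
      (5, [(bits (strip y), 0), (f, 0), (g, 0)])"
proof (induction y rule: rev_induct)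
  case Nil
  have "step decode K (3, [(bits [], int (length []) - 1), (f, -1), (g, -1)]) (5, [(bits (strip []), 0), (f, 0), (g, 0)])"
    unfolding decode_def
    by (rule table_step[OF decode_lookup(9)]) (use assms in \<open>simp_all add: fun_upd_idem\<close>)
  then show ?case by (intro exI[of _ 1] conjI relpowp_single) simp_all
next
  case (snoc b y)
  have e: "(bits (y @ [b]))(int (length y) := Blank) = bits y" "bits (y @ [b]) (int (length y)) = Bit b"
    using bits_take[of "length y" "y @ [b]"] bits_nth[of "length y" "y @ [b]"] by simp_all
  show ?case
  proof (cases b)
    case False
    from snoc obtain m where m: "m \<le> length y + 1" "(step decode K ^^ m)
       (3, [(bits y, int (length y) - 1), (f, -1), (g, -1)]) (5, [(bits (strip y), 0), (f, 0), (g, 0)])" by blast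
    have "step decode K (3, [(bits (y @ [b]), int (length (y @ [b])) - 1), (f, -1), (g, -1)])
        (3, [(bits y, int (length y) - 1), (f, -1), (g, -1)])"
      unfolding decode_def
      by (rule table_step[OF decode_lookup(7)]) (use assms e False in \<open>simp_all add: fun_upd_idem\<close>)
    from relpowp_Suc_I2[OF this m(2)] show ?thesis
      using m(1) False by (intro exI[of _ "Suc m"]) simp
  next
    case True
    have "step decode K (3, [(bits (y @ [b]), int (length (y @ [b])) - 1), (f, -1), (g, -1)])
        (4, [(bits y, int (length y) - 1), (f, -1), (g, -1)])"
      unfolding decode_def
      by (rule table_step[OF decode_lookup(8)]) (use assms e True in \<open>simp_all add: fun_upd_idem\<close>)
    moreover have "(step decode K ^^ Suc (length y)) (4, [(bits y, int (length y) - 1), (f, -1), (g, -1)])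
        (5, [(bits y, 0), (f, 0), (g, 0)])"
      unfolding decode_def
      using bits_rewind[OF decode_lookup(10,11), of f "-1" g "-1" "length y" y] assms by simp
    ultimately have "(step decode K ^^ Suc (Suc (length y)))
        (3, [(bits (y @ [b]), int (length (y @ [b])) - 1), (f, -1), (g, -1)]) (5, [(bits y, 0), (f, 0), (g, 0)])"
      by (rule relpowp_Suc_I2)
    then show ?thesis using True by (intro exI[of _ "Suc (Suc (length y))"]) simp
  qed
qed

text \<open>For odd length the middle bit goes to the front. Tabulated inputs have even length, but
  the decoder has to treat every string.\<close>

definition front_half :: "bool list \<Rightarrow> bool list" where
  "front_half z = take (length z - length z div 2) z"

definition back_half :: "bool list \<Rightarrow> bool list" where
  "back_half z = drop (length z - length z div 2) z"

lemma length_back_half [simp]: "length (back_half z) = length z div 2"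
  by (simp add: back_half_def)

lemma halves_append: "length y = length t \<Longrightarrow> front_half (y @ t) = y \<and> back_half (y @ t) = t"
  by (simp add: front_half_def back_half_def)

text \<open>The table is copied from its right end; \<open>k\<close> is the leftmost position
  already present, and \<open>k = 0\<close> gives the whole table.\<close>

definition entry :: "bool list \<Rightarrow> nat \<Rightarrow> int \<Rightarrow> bool option" where
  "entry t k i = (if int k \<le> i \<and> i < int (length t) then Some (t ! nat i) else None)"

lemma entry_Suc: "k < length t \<Longrightarrow>
   (\<lambda>i. cell (Blank, entry t (Suc k) i, False))(int k := cell (Blank, Some (t ! k), False)) =
   (\<lambda>i. cell (Blank, entry t k i, False))"
  by (auto simp: entry_def fun_eq_iff)

lemma decode_run:
  "\<exists>m \<le> poly [:6, 3:] (length z). (step decode K ^^ m) (0, [(bits z, 0), (marks 0, 0), (marks 0, 0)])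
     (5, [(bits (strip (front_half z)), 0), (\<lambda>i. cell (Blank, entry (back_half z) 0 i, False), 0),
        (marks (length (back_half z)), 0)])"
proof -
  let ?R = "step decode K" and ?N = "length z" and ?n = "length z div 2" and ?t = "back_half z"
  let ?T = "\<lambda>k. \<lambda>i. cell (Blank, entry ?t k i, False)"
  have out: "bits z (int ?N) = Blank" by simp
  have T: "?T ?n = marks 0" by (auto simp: entry_def fun_eq_iff)
  have Tout: "?T k (int k - 1) = Blank" for k by (simp add: entry_def)
  \<comment> \<open>Each round reads two input cells and writes one mark, so the number of marks is
    half the length of the input, rounded down.\<close>
  have "(?R ^^ (?n * 2)) (0, [(bits z, int (2 * 0)), (marks 0, int 0), (marks 0, int 0)])
       (0, [(bits z, int (2 * ?n)), (marks 0, int ?n), (marks ?n, int ?n)])"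
  proof (rule relpowp_loop[where c = "\<lambda>i. (0, [(bits z, int (2 * i)), (marks 0, int i), (marks i, int i)])"])
    fix i assume i: "i < ?n"
    have "?R (0, [(bits z, int (2 * i)), (marks 0, int i), (marks i, int i)])
        (1, [(bits z, int (2 * i + 1)), (marks 0, int i), (marks i, int i)])"
      unfolding decode_def by (rule table_step[OF decode_lookup(1)[of "z ! (2 * i)"]])
        (use i bits_nth[of "2 * i" z] bits_idem[of "2 * i" z] in \<open>simp_all add: fun_upd_idem\<close>)
    moreover have "?R (1, [(bits z, int (2 * i + 1)), (marks 0, int i), (marks i, int i)])
        (0, [(bits z, int (2 * Suc i)), (marks 0, int (Suc i)), (marks (Suc i), int (Suc i))])"
      unfolding decode_def by (rule table_step[OF decode_lookup(2)[of "z ! (2 * i + 1)"]])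
        (use i bits_nth[of "2 * i + 1" z] bits_idem[of "2 * i + 1" z] in \<open>simp_all add: fun_upd_idem marks_Suc\<close>)
    ultimately have "(?R ^^ (1 + 1)) (0, [(bits z, int (2 * i)), (marks 0, int i), (marks i, int i)])
        (0, [(bits z, int (2 * Suc i)), (marks 0, int (Suc i)), (marks (Suc i), int (Suc i))])"
      by (intro relpowp_trans relpowp_single)
    then show "(?R ^^ 2) (0, [(bits z, int (2 * i)), (marks 0, int i), (marks i, int i)])
        (0, [(bits z, int (2 * Suc i)), (marks 0, int (Suc i)), (marks (Suc i), int (Suc i))])"
      by (simp only: one_add_one)
  qed
  \<comment> \<open>For odd length one bit is still to be read, so the end of the input is found in
    state 1 instead of state 0.\<close>
  moreover have "\<exists>m \<le> 2. (?R ^^ m) (0, [(bits z, int (2 * ?n)), (marks 0, int ?n), (marks ?n, int ?n)])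
      (2, [(bits z, int ?N - 1), (marks 0, int ?n - 1), (marks ?n, int ?n - 1)])"
  proof (cases "even ?N")
    case True
    then have e: "2 * ?n = ?N" by simp
    have "?R (0, [(bits z, int ?N), (marks 0, int ?n), (marks ?n, int ?n)])
      (2, [(bits z, int ?N - 1), (marks 0, int ?n - 1), (marks ?n, int ?n - 1)])"
      unfolding decode_def
      by (rule table_step[OF decode_lookup(3)]) (use out in \<open>simp_all add: fun_upd_idem\<close>)
    then show ?thesis unfolding e by (intro exI[of _ 1] conjI relpowp_single) simp_all
  next
    case False
    then have e: "2 * ?n + 1 = ?N" by presburger
    then have "2 * ?n < ?N" by linarith
    then have "?R (0, [(bits z, int (2 * ?n)), (marks 0, int ?n), (marks ?n, int ?n)])
      (1, [(bits z, int ?N), (marks 0, int ?n), (marks ?n, int ?n)])"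
      unfolding decode_def by (intro table_step[OF decode_lookup(1)[of "z ! (2 * ?n)"]])
       (use bits_nth[of "2 * ?n" z] bits_idem[of "2 * ?n" z] e arg_cong[OF e, of int] in \<open>simp_all add: fun_upd_idem\<close>)
    moreover have "?R (1, [(bits z, int ?N), (marks 0, int ?n), (marks ?n, int ?n)])
      (2, [(bits z, int ?N - 1), (marks 0, int ?n - 1), (marks ?n, int ?n - 1)])"
      unfolding decode_def
      by (rule table_step[OF decode_lookup(4)]) (use out in \<open>simp_all add: fun_upd_idem\<close>)
    ultimately have "(?R ^^ (1 + 1)) (0, [(bits z, int (2 * ?n)), (marks 0, int ?n), (marks ?n, int ?n)])
      (2, [(bits z, int ?N - 1), (marks 0, int ?n - 1), (marks ?n, int ?n - 1)])"
      by (intro relpowp_trans relpowp_single)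
    then show ?thesis by (intro exI[of _ "1 + 1"] conjI) simp_all
  qed
  then obtain a where "a \<le> 2" "(?R ^^ a) (0, [(bits z, int (2 * ?n)), (marks 0, int ?n), (marks ?n, int ?n)])
      (2, [(bits z, int ?N - 1), (marks 0, int ?n - 1), (marks ?n, int ?n - 1)])" by blast
  \<comment> \<open>All three heads walk left together; the marks on the last tape run out when the
    second half has been moved.\<close>
  moreover have "(?R ^^ ?n)
      (2, [(bits (take (?N - 0) z), int (?N - 0) - 1), (?T (?n - 0), int (?n - 0) - 1), (marks ?n, int (?n - 0) - 1)])
      (2, [(bits (take (?N - ?n) z), int (?N - ?n) - 1), (?T (?n - ?n), int (?n - ?n) - 1), (marks ?n, int (?n - ?n) - 1)])"
  proof (rule relpowp_loop1[where c = "\<lambda>i. (2, [(bits (take (?N - i) z), int (?N - i) - 1),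
       (?T (?n - i), int (?n - i) - 1), (marks ?n, int (?n - i) - 1)])"])
    fix i assume i: "i < ?n"
    then obtain k where k: "?n - i = Suc k" "?n - Suc i = k" by (metis Suc_diff_Suc)
    have kn: "k < ?n" using k by linarith
    from i have "i < ?N" by linarith
    then obtain l where l: "?N - i = Suc l" "?N - Suc i = l" by (metis Suc_diff_Suc)
    have lN: "l < ?N" using l by linarith
    \<comment> \<open>Both heads are equally far from the ends at which they started, so bit
      \<open>l\<close> of the input becomes entry \<open>k\<close> of the table.\<close>
    have "?N - ?n + k = l" using k l i by linarith
    then have tk: "?t ! k = z ! l" unfolding back_half_def by (subst nth_drop) auto
    have 1: "bits (take (Suc l) z) (int l) = Bit (z ! l)" using bits_nth[of l "take (Suc l) z"] lN by simp
    show "?R (2, [(bits (take (?N - i) z), int (?N - i) - 1), (?T (?n - i), int (?n - i) - 1), (marks ?n, int (?n - i) - 1)])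
      (2, [(bits (take (?N - Suc i) z), int (?N - Suc i) - 1), (?T (?n - Suc i), int (?n - Suc i) - 1), (marks ?n, int (?n - Suc i) - 1)])"
      unfolding k l decode_def
      by (rule table_step[OF decode_lookup(5)[of "z ! l"]])
        (use kn 1 bits_take[OF lN] entry_Suc[of k ?t] tk Tout[of "Suc k"] in \<open>simp_all\<close>)
  qed
  moreover have "?R
      (2, [(bits (take (?N - ?n) z), int (?N - ?n) - 1), (?T (?n - ?n), int (?n - ?n) - 1), (marks ?n, int (?n - ?n) - 1)])
      (3, [(bits (front_half z), int (length (front_half z)) - 1), (?T 0, - 1), (marks ?n, - 1)])"
    unfolding decode_def
    by (rule table_step[OF decode_lookup(6)[OF bits_cell[of "front_half z" "int (length (front_half z)) - 1"]]])
      (use Tout[of 0] in \<open>simp_all add: front_half_def fun_upd_idem\<close>)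
  moreover obtain b where "b \<le> length (front_half z) + 1"
     "(?R ^^ b) (3, [(bits (front_half z), int (length (front_half z)) - 1), (?T 0, - 1), (marks ?n, - 1)])
       (5, [(bits (strip (front_half z)), 0), (?T 0, 0), (marks ?n, 0)])"
    using strip_run[of "?T 0" "marks ?n" "front_half z" K] Tout[of 0] by auto
  ultimately have "(?R ^^ (?n * 2 + (a + (?n + (1 + b))))) (0, [(bits z, 0), (marks 0, 0), (marks 0, 0)])
     (5, [(bits (strip (front_half z)), 0), (?T 0, 0), (marks (length ?t), 0)])"
    by (intro relpowp_trans relpowp_single) (simp_all add: T)
  moreover have "?n * 2 + (a + (?n + (1 + b))) \<le> poly [:6, 3:] ?N"
    using \<open>a \<le> 2\<close> \<open>b \<le> length (front_half z) + 1\<close> by (simp add: front_half_def)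
  ultimately show ?thesis by blast
qed

section \<open>Simulating an oracle machine with a table\<close>

text \<open>A query is simulated by marking the head position (\<open>Run\<close>), walking to cell 0, scanning the query
  word from there, and walking back to the mark; the flags record whether the head was at a
  nonnegative position and the answer.\<close>

datatype sim_state = Run nat | Seek_left | Seek_right | Scan bool | Back bool bool | Return bool

instance sim_state :: countable
  by countable_datatype

text \<open>The last component of the result says whether the clock ticks. A query counts as one
  simulated step, so only the return to a \<open>Run\<close> state ticks. A \<open>None\<close>
  entry is read as a cell left of cell 0. In \<open>Scan\<close> the first cell other than a 0
  decides: a 1 there means that the word is not a tally word, so the answer is no; otherwise the
  entry of this very cell is the answer.\<close>

fun lookup :: "nat \<times> nat \<times> nat \<Rightarrow> sim_state \<Rightarrow> cell \<Rightarrow> (sim_state \<times> cell \<times> move \<times> bool) option" where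
  "lookup (p, y, n) (Run q) (s, e, h) =
     (if q = p then if e = None then Some (Seek_right, (s, e, True), Right, False)
        else Some (Seek_left, (s, e, True), Left, False)
      else None)"
| "lookup _ Seek_left (s, e, h) =
     (if e = None then Some (Scan True, (s, e, h), Right, False) else Some (Seek_left, (s, e, h), Left, False))"
| "lookup _ Seek_right (s, e, h) =
     (if e = None then Some (Seek_right, (s, e, h), Right, False) else Some (Scan False, (s, e, h), Stay, False))"
| "lookup _ (Scan d) (s, e, h) =
     (case e of None \<Rightarrow> None
      | Some b \<Rightarrow> if s = Bit False then Some (Scan d, (s, e, h), Right, False)
          else Some (Back d (b \<and> s \<noteq> Bit True), (s, e, h), Stay, False))"
| "lookup (p, y, n) (Back d b) (s, e, h) =
     (if h then Some (Run (if b then y else n), (s, e, False), Stay, True)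
      else if e = None \<and> d then Some (Return b, (s, e, h), Right, False)
      else Some (Back d b, (s, e, h), Left, False))"
| "lookup (p, y, n) (Return b) (s, e, h) =
     (if h then Some (Run (if b then y else n), (s, e, False), Stay, True)
      else Some (Return b, (s, e, h), Right, False))"

lemma lookup_fst: "lookup o' s c = Some (s', c', m, b) \<Longrightarrow> fst c' = fst c"
  by (cases "(o', s, c)" rule: lookup.cases) (auto split: if_splits option.splits)

text \<open>Among the infinitely many states \<open>Run q\<close> only the query state starts a
  lookup; this is what makes the set of lookup transitions finite.\<close>

lemma lookup_states:
  "lookup (p, y, n) s c \<noteq> None \<Longrightarrow>
    s \<in> {Run p, Seek_left, Seek_right} \<union> range Scan \<union> range (\<lambda>(d, b). Back d b) \<union> range Return"
  by (cases "((p, y, n), s, c)" rule: lookup.cases) (auto split: if_splits)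

text \<open>Blanks, input bits and everything the machine writes: a finite set that contains
  whatever can occur on a tape, although the type of symbols is infinite.\<close>

definition alphabet :: "machine \<Rightarrow> symbol set" where
  "alphabet M = insert Blank (range Bit) \<union> (\<Union>(q, rs, q', as) \<in> trans M. fst ` set as)"

lemma finite_alphabet: "finite (trans M) \<Longrightarrow> finite (alphabet M)"
  by (auto simp: alphabet_def)

lemma alphabet_simps [simp]: "Blank \<in> alphabet M" "Bit b \<in> alphabet M"
  by (auto simp: alphabet_def)

lemma alphabet_trans: "(q, rs, q', as) \<in> trans M \<Longrightarrow> a \<in> set as \<Longrightarrow> fst a \<in> alphabet M"
  by (force simp: alphabet_def)

definition tick :: "bool \<Rightarrow> move" where
  "tick b = (if b then Right else Stay)"

type_synonym transition = "nat \<times> symbol list \<times> nat \<times> (symbol \<times> move) list"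

text \<open>Each transition is copied for every possible table entry \<open>e\<close>, which it
  preserves. The parking flag is off outside queries, and demanding \<open>Aux 0\<close> on the last
  tape stops the machine when the clock has run out.\<close>

definition run_trans :: "machine \<Rightarrow> transition set" where
  "run_trans M =
     (\<lambda>((q, rs, q', as), e). (to_nat (Run q), rs ! 0 # cell (rs ! 1, e, False) # drop 2 rs @ [Aux 0],
         to_nat (Run q'), as ! 0 # (cell (fst (as ! 1), e, False), snd (as ! 1)) # drop 2 as @ [(Aux 0, Right)]))
       ` (trans M \<times> UNIV)"

text \<open>The remaining simulated tapes are kept unchanged by writing back what is scanned, so
  there is one transition for every combination of their symbols.\<close>

definition lookup_trans :: "machine \<Rightarrow> transition set" where
  "lookup_trans M =
     {(to_nat s, r # cell c # rs @ [Aux 0],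
         to_nat s', (r, Stay) # (cell c', m) # map (\<lambda>r. (r, Stay)) rs @ [(Aux 0, tick b)]) |
        s c s' c' m b r rs. lookup (the (orac M)) s c = Some (s', c', m, b) \<and> fst c \<in> alphabet M \<and>
          r \<in> alphabet M \<and> set rs \<subseteq> alphabet M \<and> length rs = tapes M - 2}"

text \<open>The last tape is a clock, advanced once per simulated step; the run stops when it leaves the marks.
  This bounds the running time for every table, and it keeps the simulated query head and query words
  within the table, so that a cell off the table always lies to the left of cell 0.\<close>

definition simulator :: "machine \<Rightarrow> machine" where
  "simulator M = \<lparr>tapes = tapes M + 1, trans = run_trans M \<union> lookup_trans M,
     start = to_nat (Run (start M)), accept = to_nat (Run (accept M)), orac = None\<rparr>"

lemma simulator_simps [simp]:
  "tapes (simulator M) = tapes M + 1" "start (simulator M) = to_nat (Run (start M))"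
  "accept (simulator M) = to_nat (Run (accept M))" "orac (simulator M) = None"
  "trans (simulator M) = run_trans M \<union> lookup_trans M"
  by (simp_all add: simulator_def)

lemma run_trans_iff:
  "(p, ss, p', bs) \<in> run_trans M \<longleftrightarrow>
    (\<exists>q rs q' as e. (q, rs, q', as) \<in> trans M \<and> p = to_nat (Run q) \<and> p' = to_nat (Run q') \<and>
       ss = rs ! 0 # cell (rs ! 1, e, False) # drop 2 rs @ [Aux 0] \<and>
       bs = as ! 0 # (cell (fst (as ! 1), e, False), snd (as ! 1)) # drop 2 as @ [(Aux 0, Right)])"
proof
  assume "(p, ss, p', bs) \<in> run_trans M"
  then show "\<exists>q rs q' as e. (q, rs, q', as) \<in> trans M \<and> p = to_nat (Run q) \<and> p' = to_nat (Run q') \<and>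
       ss = rs ! 0 # cell (rs ! 1, e, False) # drop 2 rs @ [Aux 0] \<and>
       bs = as ! 0 # (cell (fst (as ! 1), e, False), snd (as ! 1)) # drop 2 as @ [(Aux 0, Right)]"
    unfolding run_trans_def by clarify blast
next
  assume "\<exists>q rs q' as e. (q, rs, q', as) \<in> trans M \<and> p = to_nat (Run q) \<and> p' = to_nat (Run q') \<and>
       ss = rs ! 0 # cell (rs ! 1, e, False) # drop 2 rs @ [Aux 0] \<and>
       bs = as ! 0 # (cell (fst (as ! 1), e, False), snd (as ! 1)) # drop 2 as @ [(Aux 0, Right)]"
  then obtain q rs q' as e where "((q, rs, q', as), e) \<in> trans M \<times> UNIV" "p = to_nat (Run q)" "p' = to_nat (Run q')"
       "ss = rs ! 0 # cell (rs ! 1, e, False) # drop 2 rs @ [Aux 0]"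
       "bs = as ! 0 # (cell (fst (as ! 1), e, False), snd (as ! 1)) # drop 2 as @ [(Aux 0, Right)]" by blast
  then show "(p, ss, p', bs) \<in> run_trans M"
    unfolding run_trans_def by (intro rev_image_eqI[of "((q, rs, q', as), e)"]) simp_all
qed

lemma lookup_trans_iff:
  "(p, ss, p', bs) \<in> lookup_trans M \<longleftrightarrow>
    (\<exists>s c s' c' m b r rs. lookup (the (orac M)) s c = Some (s', c', m, b) \<and> fst c \<in> alphabet M \<and>
       r \<in> alphabet M \<and> set rs \<subseteq> alphabet M \<and> length rs = tapes M - 2 \<and> p = to_nat s \<and> p' = to_nat s' \<and>
       ss = r # cell c # rs @ [Aux 0] \<and>
       bs = (r, Stay) # (cell c', m) # map (\<lambda>r. (r, Stay)) rs @ [(Aux 0, tick b)])"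
  unfolding lookup_trans_def by blast

locale oracle_machine =
  fixes M :: machine and p y n :: nat
  assumes wf: "wf_machine M" and orac: "orac M = Some (p, y, n)"
begin

lemma M_facts: "2 \<le> tapes M" "p \<noteq> accept M" "(p, rs, q', as) \<notin> trans M"
  using wf_machineD(4,5)[OF wf orac] by auto

lemma wf_simulator: "wf_machine (simulator M)"
proof -
  let ?S = "{Run p, Seek_left, Seek_right} \<union> range Scan \<union> range (\<lambda>(d, b). Back d b) \<union> range Return"
  let ?C = "alphabet M \<times> (UNIV :: bool option set) \<times> (UNIV :: bool set)"
  let ?L = "{rs. set rs \<subseteq> alphabet M \<and> length rs = tapes M - 2}"
  let ?f = "\<lambda>(s, c, r, rs). case the (lookup (p, y, n) s c) of (s', c', m, b) \<Rightarrow> (to_nat s, r # cell c # rs @ [Aux 0],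
           to_nat s', (r, Stay) # (cell c', m) # map (\<lambda>r. (r, Stay)) rs @ [(Aux 0, tick b)])"
  have fin: "finite (trans M)" and t2: "2 \<le> tapes M" using wf_machineD[OF wf] M_facts by auto
  \<comment> \<open>The state, the scanned cell and the symbols on the other tapes range over finite
    sets and determine the transition.\<close>
  have "finite (?f ` (?S \<times> ?C \<times> alphabet M \<times> ?L))"
    using finite_alphabet[OF fin] finite_lists_length_eq[OF finite_alphabet[OF fin]] by auto
  moreover have "lookup_trans M \<subseteq> ?f ` (?S \<times> ?C \<times> alphabet M \<times> ?L)"
  unfolding lookup_trans_def
  proof clarify
    fix s c s' c' m b r rs
    assume a: "lookup (the (orac M)) s c = Some (s', c', m, b)" "fst c \<in> alphabet M"
      "r \<in> alphabet M" "set rs \<subseteq> alphabet M" "length rs = tapes M - 2"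
    have l: "lookup (p, y, n) s c = Some (s', c', m, b)" using a(1) orac by simp
    then have "lookup (p, y, n) s c \<noteq> None" by simp
    then have "s \<in> ?S" by (rule lookup_states)
    moreover have "c \<in> ?C" using a(2) by (cases c) auto
    ultimately have "(s, c, r, rs) \<in> ?S \<times> ?C \<times> alphabet M \<times> ?L" using a(3-5) by blast
    then show "(to_nat s, r # cell c # rs @ [Aux 0],
           to_nat s', (r, Stay) # (cell c', m) # map (\<lambda>r. (r, Stay)) rs @ [(Aux 0, tick b)])
        \<in> ?f ` (?S \<times> ?C \<times> alphabet M \<times> ?L)"
      by (rule rev_image_eqI) (simp add: l)
  qed
  ultimately have "finite (trans (simulator M))"
    using fin finite_subset by (auto simp: run_trans_def)
  moreover have "length ss = tapes M + 1 \<and> length bs = tapes M + 1 \<and> q \<noteq> to_nat (Run (accept M))"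
    if "(q, ss, q', bs) \<in> trans (simulator M)" for q ss q' bs
    using that unfolding simulator_simps Un_iff run_trans_iff lookup_trans_iff
  proof (elim disjE exE conjE)
    fix q0 rs q0' as e assume "(q0, rs, q0', as) \<in> trans M" "q = to_nat (Run q0)"
      "ss = rs ! 0 # cell (rs ! 1, e, False) # drop 2 rs @ [Aux 0]"
      "bs = as ! 0 # (cell (fst (as ! 1), e, False), snd (as ! 1)) # drop 2 as @ [(Aux 0, Right)]"
    with wf_machineD(3)[OF wf] t2 show ?thesis by fastforce
  next
    fix s c s' c' m b r rs
    assume "lookup (the (orac M)) s c = Some (s', c', m, b)" "length rs = tapes M - 2" "q = to_nat s"
      "ss = r # cell c # rs @ [Aux 0]"
      "bs = (r, Stay) # (cell c', m) # map (\<lambda>r. (r, Stay)) rs @ [(Aux 0, tick b)]"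
    moreover have "lookup (p, y, n) (Run (accept M)) c = None" using M_facts(2) by (cases c) simp
    ultimately show ?thesis using orac t2 by auto
  qed
  ultimately show ?thesis unfolding wf_machine_def by auto
qed

text \<open>The tapes \<open>a\<close> and \<open>rest\<close> are frozen during a query, so the
  varying data are the state, the contents and head of the query tape, and the clock position
  \<open>k\<close>.\<close>

definition scfg :: "tape \<Rightarrow> tape list \<Rightarrow> nat \<Rightarrow> sim_state \<times> (int \<Rightarrow> cell) \<times> int \<times> nat \<Rightarrow> config" where
  "scfg a rest N = (\<lambda>(s, F, h, k). (to_nat s, a # (\<lambda>i. cell (F i), h) # rest @ [(marks N, int k)]))"

definition sim :: "bool list \<Rightarrow> config \<Rightarrow> nat \<Rightarrow> config" where
  "sim t c k = (case c of (q, a # (f, h) # rest) \<Rightarrow>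
     scfg a rest (length t) (Run q, \<lambda>i. (f i, entry t 0 i, False), h, k))"

text \<open>A query is analysed in this small deterministic system, free of tape lists and codings;
  \<open>scfg_det_run\<close> transfers its runs to the simulator.\<close>

definition lookup_step :: "nat \<Rightarrow> sim_state \<times> (int \<Rightarrow> cell) \<times> int \<times> nat \<Rightarrow> sim_state \<times> (int \<Rightarrow> cell) \<times> int \<times> nat \<Rightarrow> bool"
  where "lookup_step N = (\<lambda>(s, F, h, k) x. k < N \<and> (\<exists>s' c m b. lookup (p, y, n) s (F h) = Some (s', c, m, b) \<and>
     x = (s', F(h := c), shift m h, if b then Suc k else k)))"

lemma scfg_step:
  assumes "scanned a \<in> alphabet M" "\<forall>r\<in>set rest. scanned r \<in> alphabet M" "length rest = tapes M - 2"
    and F: "\<forall>i. fst (F i) \<in> alphabet M" and "Ex (lookup_step N (s, F, h, k))"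
  shows "step (simulator M) K (scfg a rest N (s, F, h, k)) x \<longleftrightarrow>
    (\<exists>e. lookup_step N (s, F, h, k) e \<and> x = scfg a rest N e)"
proof -
  obtain s' c m b where l: "lookup (p, y, n) s (F h) = Some (s', c, m, b)" and k: "k < N"
    using assms(5) by (auto simp: lookup_step_def)
  let ?ts = "a # (\<lambda>i. cell (F i), h) # rest @ [(marks N, int k)]"
  let ?rs = "map scanned rest"
  have ms: "map scanned ?ts = scanned a # cell (F h) # ?rs @ [Aux 0]" using k by simp
  \<comment> \<open>The query state of \<open>M\<close> has no transitions, and the other states
    with a lookup are not of the form \<open>Run q\<close>; so no copied transition
    interferes.\<close>
  have notrun: "(q, rs, q', as) \<notin> trans M" if "to_nat s = to_nat (Run q)" for q rs q' as
    using that l M_facts(3) by (cases "F h") (auto split: if_splits)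
  have idle: "map2 write_move (map (\<lambda>r. (r, Stay)) (map scanned ts)) ts = ts" for ts :: "tape list"
  proof (induction ts)
    case (Cons t ts)
    then show ?case by (cases t) (simp add: fun_upd_idem)
  qed simp
  have a: "write_move (scanned a, Stay) a = a" by (cases a) (simp add: fun_upd_idem)
  have "(to_nat s, map scanned ?ts, p', bs) \<in> trans (simulator M) \<longleftrightarrow> p' = to_nat s' \<and>
     bs = (scanned a, Stay) # (cell c, m) # map (\<lambda>r. (r, Stay)) ?rs @ [(Aux 0, tick b)]" for p' bs
  proof
    assume "(to_nat s, map scanned ?ts, p', bs) \<in> trans (simulator M)"
    then have "(to_nat s, map scanned ?ts, p', bs) \<in> lookup_trans M"
      using notrun by (auto simp: run_trans_iff)
    then show "p' = to_nat s' \<and>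
       bs = (scanned a, Stay) # (cell c, m) # map (\<lambda>r. (r, Stay)) ?rs @ [(Aux 0, tick b)]"
      unfolding ms lookup_trans_iff using l orac by fastforce
  next
    assume "p' = to_nat s' \<and>
       bs = (scanned a, Stay) # (cell c, m) # map (\<lambda>r. (r, Stay)) ?rs @ [(Aux 0, tick b)]"
    moreover have "lookup (the (orac M)) s (F h) = Some (s', c, m, b)" "fst (F h) \<in> alphabet M"
      "set ?rs \<subseteq> alphabet M" "length ?rs = tapes M - 2" using l orac F assms(2,3) by auto
    ultimately show "(to_nat s, map scanned ?ts, p', bs) \<in> trans (simulator M)"
      unfolding ms simulator_simps Un_iff lookup_trans_iff using assms(1) by blast
  qed
  moreover have "map2 write_move ((scanned a, Stay) # (cell c, m) # map (\<lambda>r. (r, Stay)) ?rs @ [(Aux 0, tick b)]) ?ts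
     = a # (\<lambda>i. cell ((F(h := c)) i), shift m h) # rest @ [(marks N, int (if b then Suc k else k))]"
    using k idle[of rest] by (simp add: a fun_eq_iff tick_def)
  ultimately have "step (simulator M) K (scfg a rest N (s, F, h, k)) x \<longleftrightarrow>
      x = scfg a rest N (s', F(h := c), shift m h, if b then Suc k else k)"
    unfolding scfg_def prod.case step_iff by simp
  also have "\<dots> \<longleftrightarrow> (\<exists>e. lookup_step N (s, F, h, k) e \<and> x = scfg a rest N e)"
    unfolding lookup_step_def prod.case l option.inject prod.inject using k by blast
  finally show ?thesis .
qed

lemma scfg_det_run:
  assumes "scanned a \<in> alphabet M" "\<forall>r\<in>set rest. scanned r \<in> alphabet M" "length rest = tapes M - 2"
    and "\<forall>i. fst (F i) \<in> alphabet M" "(lookup_step N ^^ m) (s, F, h, k) c"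
  shows "det_run (step (simulator M) K) m (scfg a rest N (s, F, h, k)) (scfg a rest N c)"
proof (rule det_run_map[where I = "\<lambda>(s, F, h, k). \<forall>i. fst (F i) \<in> alphabet M"])
  show "det_run (lookup_step N) m (s, F, h, k) c"
    by (rule relpowp_det_run[OF assms(5)]) (auto simp: lookup_step_def)
next
  fix c e assume "lookup_step N c e" "case c of (s, F, h, k) \<Rightarrow> \<forall>i. fst (F i) \<in> alphabet M"
  then show "case e of (s, F, h, k) \<Rightarrow> \<forall>i. fst (F i) \<in> alphabet M"
    by (cases c) (auto simp: lookup_step_def dest: lookup_fst)
next
  fix c x assume "case c of (s, F, h, k) \<Rightarrow> \<forall>i. fst (F i) \<in> alphabet M" "Ex (lookup_step N c)"
  then show "step (simulator M) K (scfg a rest N c) x = (\<exists>e. lookup_step N c e \<and> x = scfg a rest N e)"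
    using scfg_step[OF assms(1-3)] by (cases c) auto
qed (use assms(4) in simp)

end

section \<open>Query words and finite tables\<close>

lemma inj_tally: "tally i = tally j \<Longrightarrow> i = j"
  using bij_str_index unfolding tally_def bij_def inj_def by (metis length_replicate)

definition table_set :: "bool list \<Rightarrow> nat set" where
  "table_set t = {tally i | i. i < length t \<and> t ! i}"

lemma query_word_length: "\<forall>b. f (int k) \<noteq> Bit b \<Longrightarrow> length (query_word (f, h)) \<le> k"
  by (simp add: query_word_def Least_le)

text \<open>Here \<open>w\<close> is the first cell that does not hold a 0. If it holds a 1, the
  query word contains a 1 and is no tally word; otherwise the query word ends there and consists of
  \<open>w\<close> zeros, so entry \<open>w\<close> is the answer.\<close>

lemma query_word_table_set:
  assumes "\<And>i. i < w \<Longrightarrow> f (int i) = Bit False" "f (int w) \<noteq> Bit False" "w < length t"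
    and "\<exists>k. \<forall>b. f (int k) \<noteq> Bit b"
  shows "str_index (query_word (f, h)) \<in> table_set t \<longleftrightarrow> t ! w \<and> f (int w) \<noteq> Bit True"
proof -
  let ?P = "\<lambda>m. \<forall>b. f (int m) \<noteq> Bit b"
  let ?l = "LEAST m. ?P m"
  have l: "?P ?l" using assms(4) by (rule LeastI_ex)
  have q: "query_word (f, h) = map (\<lambda>i. f (int i) = Bit True) [0..<?l]"
    by (simp add: query_word_def)
  have wl: "w \<le> ?l" using l assms(1) by (metis not_le_imp_less)
  show ?thesis
  proof (cases "f (int w) = Bit True")
    case True
    then have "w < ?l" using l wl by (metis le_neq_implies_less)
    then have "w < length (query_word (f, h))" "query_word (f, h) ! w" using True by (simp_all add: q)
    then have "query_word (f, h) \<noteq> replicate i False" for i by auto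
    then have "str_index (query_word (f, h)) \<noteq> tally i" for i
      using bij_str_index unfolding tally_def bij_def inj_def by blast
    with True show ?thesis by (auto simp: table_set_def)
  next
    case False
    then have "?P w" using assms(2) by (metis (full_types))
    then have "?l = w" using wl by (intro le_antisym Least_le)
    then have "query_word (f, h) = replicate w False"
      unfolding q using assms(1) by (simp add: list_eq_iff_nth_eq)
    then have "str_index (query_word (f, h)) = tally w" by (simp add: tally_def)
    then show ?thesis using False assms(3) inj_tally by (auto simp: table_set_def)
  qed
qed

context oracle_machine
begin

lemma lookup_stepI:
  assumes "lookup (p, y, n) s (F h) = Some (s', c, m, b)" "k < N" "F(h := c) = F'" "shift m h = h'"
    "(if b then Suc k else k) = k'"
  shows "lookup_step N (s, F, h, k) (s', F', h', k')"
  using assms by (cases c) (auto simp: lookup_step_def)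

text \<open>The hypotheses on \<open>h\<close> and \<open>f\<close> are what \<open>inv\<close>
  provides after \<open>k\<close> steps. They keep the query word within the table and bound every
  walk of the head by \<open>k\<close>, up to a constant.\<close>

lemma query_run:
  fixes f :: "int \<Rightarrow> symbol" and t :: "bool list"
  defines "N \<equiv> length t" and "F \<equiv> \<lambda>i. (f i, entry t 0 i, False)"
  assumes k: "k < N" and h: "\<bar>h\<bar> \<le> int k" and f: "f (int k) = Blank"
  shows "\<exists>m \<le> 4 * N + 6. (lookup_step N ^^ m) (Run p, F, h, k)
    (Run (if str_index (query_word (f, h)) \<in> table_set t then y else n), F, h, Suc k)"
proof -
  let ?R = "lookup_step N"
  \<comment> \<open>This is \<open>F\<close> with the parking flag raised at \<open>h\<close>; the
    walks in between do not change it.\<close>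
  define G where "G = (\<lambda>i. (f i, entry t 0 i, i = h))"
  define w where "w = (LEAST w. f (int w) \<noteq> Bit False)"
  have w: "f (int w) \<noteq> Bit False" unfolding w_def by (rule LeastI[of _ k]) (simp add: f)
  have less_w: "f (int i) = Bit False" if "i < w" for i using that not_less_Least w_def by blast
  \<comment> \<open>Cell \<open>k\<close> is blank, so the scan stops there at the latest, still
    inside the table.\<close>
  have wk: "w \<le> k" unfolding w_def by (rule Least_le) (simp add: f)
  define v where "v = (t ! w \<and> f (int w) \<noteq> Bit True)"
  have v: "str_index (query_word (f, h)) \<in> table_set t \<longleftrightarrow> v"
    unfolding v_def
    by (intro query_word_table_set exI[of _ k]) (use less_w w wk k f in \<open>auto simp: N_def\<close>)
  have some: "\<exists>b. entry t 0 i = Some b" if "0 \<le> i" "i < int N" for i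
    using that by (simp add: entry_def N_def)
  have none: "entry t 0 i = None" if "i < 0" for i using that by (simp add: entry_def)
  have FG: "F(h := (f h, entry t 0 h, True)) = G" "G(h := (f h, entry t 0 h, False)) = F"
    by (auto simp: F_def G_def)
  have G_triv: "G(i := (f i, entry t 0 i, False)) = G" if "i \<noteq> h" for i
    using that by (auto simp: G_def)
  \<comment> \<open>The entry under the head reveals on which side of cell 0 it is. A head on the
    table overshoots to cell -1 and steps back; a head to the left of the table stops on cell 0
    itself.\<close>
  have "\<exists>m \<le> k + 2. (?R ^^ m) (Run p, F, h, k) (Scan (0 \<le> h), G, 0, k)"
  proof (cases "0 \<le> h")
    case True
    have "?R (Run p, F, h, k) (Seek_left, G, h - 1 - int 0, k)"
      by (rule lookup_stepI[where c = "(f h, entry t 0 h, True)"])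
        (use some[of h] h k True FG in \<open>auto simp: F_def\<close>)
    moreover have "(?R ^^ nat h) (Seek_left, G, h - 1 - int 0, k) (Seek_left, G, h - 1 - int (nat h), k)"
    proof (rule relpowp_loop1[where c = "\<lambda>i. (Seek_left, G, h - 1 - int i, k)"])
      fix i assume i: "i < nat h"
      then show "?R (Seek_left, G, h - 1 - int i, k) (Seek_left, G, h - 1 - int (Suc i), k)"
        by (intro lookup_stepI[where c = "G (h - 1 - int i)"])
          (use some[of "h - 1 - int i"] h k in \<open>auto simp: G_def\<close>)
    qed
    moreover have "?R (Seek_left, G, h - 1 - int (nat h), k) (Scan (0 \<le> h), G, 0, k)"
      by (rule lookup_stepI[where c = "G (-1)"]) (use none[of "-1"] k True in \<open>auto simp: G_def\<close>)
    ultimately have "(?R ^^ (1 + (nat h + 1))) (Run p, F, h, k) (Scan (0 \<le> h), G, 0, k)"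
      by (intro relpowp_trans relpowp_single)
    then show ?thesis using h by (intro exI[of _ "1 + (nat h + 1)"] conjI) auto
  next
    case False
    let ?d = "nat (- h - 1)"
    have "?R (Run p, F, h, k) (Seek_right, G, h + 1 + int 0, k)"
      by (rule lookup_stepI[where c = "(f h, entry t 0 h, True)"])
        (use none[of h] h k False FG in \<open>auto simp: F_def\<close>)
    moreover have "(?R ^^ ?d) (Seek_right, G, h + 1 + int 0, k) (Seek_right, G, h + 1 + int ?d, k)"
    proof (rule relpowp_loop1[where c = "\<lambda>i. (Seek_right, G, h + 1 + int i, k)"])
      fix i assume i: "i < ?d"
      then show "?R (Seek_right, G, h + 1 + int i, k) (Seek_right, G, h + 1 + int (Suc i), k)"
        by (intro lookup_stepI[where c = "G (h + 1 + int i)"])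
          (use none[of "h + 1 + int i"] k in \<open>auto simp: G_def\<close>)
    qed
    moreover have "?R (Seek_right, G, h + 1 + int ?d, k) (Scan (0 \<le> h), G, 0, k)"
      by (rule lookup_stepI[where c = "G 0"]) (use some[of 0] k False in \<open>auto simp: G_def\<close>)
    ultimately have "(?R ^^ (1 + (?d + 1))) (Run p, F, h, k) (Scan (0 \<le> h), G, 0, k)"
      by (intro relpowp_trans relpowp_single)
    then show ?thesis using h by (intro exI[of _ "1 + (?d + 1)"] conjI) auto
  qed
  then obtain m1 where m1: "m1 \<le> k + 2" "(?R ^^ m1) (Run p, F, h, k) (Scan (0 \<le> h), G, int 0, k)" by auto
  have scan: "(?R ^^ w) (Scan (0 \<le> h), G, int 0, k) (Scan (0 \<le> h), G, int w, k)"
  proof (rule relpowp_loop1[where c = "\<lambda>i. (Scan (0 \<le> h), G, int i, k)"])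
    fix i assume i: "i < w"
    then show "?R (Scan (0 \<le> h), G, int i, k) (Scan (0 \<le> h), G, int (Suc i), k)"
      by (intro lookup_stepI[where c = "G (int i)"])
        (use some[of "int i"] less_w wk k in \<open>auto simp: G_def\<close>)
  qed
  have "entry t 0 (int w) = Some (t ! w)" using wk k by (simp add: entry_def N_def)
  then have stop: "?R (Scan (0 \<le> h), G, int w, k) (Back (0 \<le> h) v, G, int w, k)"
    by (intro lookup_stepI[where c = "G (int w)"]) (use w k in \<open>auto simp: G_def v_def\<close>)
  let ?end = "(Run (if v then y else n), F, h, Suc k)"
  \<comment> \<open>The parked position may lie on either side of \<open>w\<close>, so the search
    goes left first. On reaching cell -1 it turns only if the head was parked at a nonnegative
    position; otherwise the mark is further left.\<close>
  have "\<exists>m \<le> 2 * k + 3. (?R ^^ m) (Back (0 \<le> h) v, G, int w, k) ?end"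
  proof (cases "h \<le> int w")
    case True
    let ?d = "nat (int w - h)"
    have "(?R ^^ ?d) (Back (0 \<le> h) v, G, int w - int 0, k) (Back (0 \<le> h) v, G, int w - int ?d, k)"
    proof (rule relpowp_loop1[where c = "\<lambda>i. (Back (0 \<le> h) v, G, int w - int i, k)"])
      fix i assume i: "i < ?d"
      have "i \<le> w" if "0 \<le> h" using i that by linarith
      with i show "?R (Back (0 \<le> h) v, G, int w - int i, k) (Back (0 \<le> h) v, G, int w - int (Suc i), k)"
        by (intro lookup_stepI[where c = "G (int w - int i)"])
          (use some[of "int w - int i"] k wk in \<open>auto simp: G_def\<close>)
    qed
    moreover have "?R (Back (0 \<le> h) v, G, int w - int ?d, k) ?end"
      by (rule lookup_stepI[where c = "(f h, entry t 0 h, False)"]) (use True k FG in \<open>auto simp: G_def\<close>)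
    ultimately have "(?R ^^ (?d + 1)) (Back (0 \<le> h) v, G, int w - int 0, k) ?end"
      by (intro relpowp_trans relpowp_single)
    then show ?thesis using h wk by (intro exI[of _ "?d + 1"] conjI) auto
  next
    case False
    have "(?R ^^ Suc w) (Back (0 \<le> h) v, G, int w - int 0, k) (Back (0 \<le> h) v, G, int w - int (Suc w), k)"
    proof (rule relpowp_loop1[where c = "\<lambda>i. (Back (0 \<le> h) v, G, int w - int i, k)"])
      fix i assume i: "i < Suc w"
      then show "?R (Back (0 \<le> h) v, G, int w - int i, k) (Back (0 \<le> h) v, G, int w - int (Suc i), k)"
        by (intro lookup_stepI[where c = "G (int w - int i)"])
          (use some[of "int w - int i"] k wk False in \<open>auto simp: G_def\<close>)
    qed
    moreover have "?R (Back (0 \<le> h) v, G, int w - int (Suc w), k) (Return v, G, int 0, k)"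
      by (rule lookup_stepI[where c = "G (-1)"]) (use none[of "-1"] k False in \<open>auto simp: G_def\<close>)
    moreover have "(?R ^^ nat h) (Return v, G, int 0, k) (Return v, G, int (nat h), k)"
    proof (rule relpowp_loop1[where c = "\<lambda>i. (Return v, G, int i, k)"])
      fix i assume "i < nat h"
      then show "?R (Return v, G, int i, k) (Return v, G, int (Suc i), k)"
        by (intro lookup_stepI[where c = "G (int i)"]) (use k in \<open>auto simp: G_def\<close>)
    qed
    moreover have "?R (Return v, G, int (nat h), k) ?end"
      by (rule lookup_stepI[where c = "(f h, entry t 0 h, False)"]) (use False k FG in \<open>auto simp: G_def\<close>)
    ultimately have "(?R ^^ (Suc w + (1 + (nat h + 1)))) (Back (0 \<le> h) v, G, int w - int 0, k) ?end"
      by (intro relpowp_trans relpowp_single)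
    then show ?thesis using h wk by (intro exI[of _ "Suc w + (1 + (nat h + 1))"] conjI) auto
  qed
  then obtain m2 where m2: "m2 \<le> 2 * k + 3" "(?R ^^ m2) (Back (0 \<le> h) v, G, int w, k) ?end" by blast
  have "(?R ^^ (m1 + (w + (1 + m2)))) (Run p, F, h, k) ?end"
    using m1(2) scan stop m2(2) by (intro relpowp_trans relpowp_single)
  \<comment> \<open>The parts add up to at most (k + 2) + k + 1 + (2k + 3) = 4k + 6.\<close>
  moreover have "m1 + (w + (1 + m2)) \<le> 4 * N + 6" using m1(1) m2(1) wk k by linarith
  ultimately show ?thesis unfolding v by blast
qed

text \<open>What holds after \<open>k\<close> steps: the head of tape 1 is at most \<open>k\<close>
  cells away from its start, and it has written only to cells below \<open>k\<close>. Hence a query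
  word has length at most \<open>k\<close>.\<close>

definition inv :: "nat \<Rightarrow> tape list \<Rightarrow> bool" where
  "inv k ts \<longleftrightarrow> (\<exists>a f h rest. ts = a # (f, h) # rest \<and> length rest = tapes M - 2 \<and>
     range (fst a) \<subseteq> alphabet M \<and> range f \<subseteq> alphabet M \<and> (\<forall>r\<in>set rest. range (fst r) \<subseteq> alphabet M) \<and>
     \<bar>h\<bar> \<le> int k \<and> (\<forall>i \<ge> int k. f i = Blank))"

lemma inv_initial: "inv 0 (snd (initial M x))"
proof -
  have "tapes M - 1 = Suc (tapes M - 2)" using M_facts by linarith
  then show ?thesis
    by (auto simp: inv_def initial_def blank_tape_def input_tape_def)
qed

lemma write_move_alphabet:
  assumes "fst b \<in> alphabet M" "range (fst a) \<subseteq> alphabet M"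
  shows "range (fst (write_move b a)) \<subseteq> alphabet M"
  using assms by (cases b; cases a) (auto simp: image_subset_iff)

lemma inv_step:
  assumes "inv k ts" "step M K (q, ts) (q', ts')"
  shows "inv (Suc k) ts'"
proof -
  from assms(1) obtain a f h rest where ts: "ts = a # (f, h) # rest" and len: "length rest = tapes M - 2"
    and al: "range (fst a) \<subseteq> alphabet M" "range f \<subseteq> alphabet M" "\<forall>r\<in>set rest. range (fst r) \<subseteq> alphabet M"
    and h: "\<bar>h\<bar> \<le> int k" and bl: "\<forall>i \<ge> int k. f i = Blank"
    unfolding inv_def by blast
  from assms(2) show ?thesis unfolding step_iff
  proof (elim disjE exE conjE)
    fix q1 as assume t: "(q, map scanned ts, q1, as) \<in> trans M" and e: "(q', ts') = (q1, map2 write_move as ts)"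
    have "length as = tapes M" using wf_machineD(3)[OF wf t] by blast
    then have "length as = Suc (Suc (tapes M - 2))" using M_facts(1) by linarith
    then obtain b c d as' where as: "as = b # (c, d) # as'" and las: "length as' = length rest"
      unfolding len by (auto simp: length_Suc_conv)
    have ts': "ts' = write_move b a # (f(h := c), shift d h) # map2 write_move as' rest"
      using e ts as by simp
    have in_al: "fst z \<in> alphabet M" if "z \<in> set as" for z using alphabet_trans[OF t that] .
    have "range (fst (write_move b a)) \<subseteq> alphabet M"
      by (rule write_move_alphabet) (use in_al al as in auto)
    moreover have "range (f(h := c)) \<subseteq> alphabet M" using in_al[of "(c, d)"] al(2) as by auto
    moreover have "\<forall>r\<in>set (map2 write_move as' rest). range (fst r) \<subseteq> alphabet M"
    proof
      fix r assume "r \<in> set (map2 write_move as' rest)"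
      then obtain zu where "zu \<in> set (zip as' rest)" "r = (case zu of (z, u) \<Rightarrow> write_move z u)"
        by (auto simp only: set_map)
      moreover obtain z u where "zu = (z, u)" by (cases zu)
      ultimately have "r = write_move z u" "z \<in> set as'" "u \<in> set rest"
        using set_zip_leftD[of z u as' rest] set_zip_rightD[of z u as' rest] by simp_all
      then show "range (fst r) \<subseteq> alphabet M" using write_move_alphabet in_al al(3) as by auto
    qed
    moreover have "\<bar>shift d h\<bar> \<le> int (Suc k)" using h by (cases d) auto
    moreover have "\<forall>i \<ge> int (Suc k). (f(h := c)) i = Blank" using h bl by auto
    ultimately show ?thesis unfolding inv_def ts' using las len
      by (intro exI[of _ "write_move b a"] exI[of _ "f(h := c)"] exI[of _ "shift d h"]
          exI[of _ "map2 write_move as' rest"] conjI) simp_all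
  next
    fix y' n' assume "(q', ts') = (reply K ts y' n', ts)"
    then show ?thesis unfolding inv_def using ts len al h bl by auto
  qed
qed

lemma inv_relpowp: "(step M K ^^ l) (initial M x) c \<Longrightarrow> inv l (snd c)"
proof (induction l arbitrary: c)
  case 0
  then show ?case using inv_initial by auto
next
  case (Suc l)
  then obtain d where "(step M K ^^ l) (initial M x) d" "step M K d c" by (auto simp: relcompp_apply)
  then show ?case using Suc.IH inv_step by (cases c; cases d) fastforce
qed

text \<open>An equivalence is needed because the simulator must not gain branches: they could accept
  wrongly or run too long. No query is asked here, so the two oracles are independent of each
  other.\<close>

lemma simulator_run_step:
  assumes "inv k ts" "k < length t" "q \<noteq> p"
  shows "step (simulator M) K (sim t (q, ts) k) x \<longleftrightarrow>
    (\<exists>c. step M K' (q, ts) c \<and> x = sim t c (Suc k))"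
proof -
  from assms(1) obtain a f h rest where ts: "ts = a # (f, h) # rest" and len: "length rest = tapes M - 2"
    unfolding inv_def by blast
  let ?F = "\<lambda>i. cell (f i, entry t 0 i, False)"
  let ?ts = "a # (?F, h) # rest @ [(marks (length t), int k)]"
  let ?bs = "\<lambda>as. as ! 0 # (cell (fst (as ! 1), entry t 0 h, False), snd (as ! 1)) # drop 2 as @ [(Aux 0, Right)]"
  have sim: "sim t (q, ts) k = (to_nat (Run q), ?ts)" by (simp add: sim_def ts scfg_def)
  have ms: "map scanned ?ts = scanned a # ?F h # map scanned rest @ [Aux 0]" using assms(2) by simp
  have l: "length rs = Suc (Suc (length rest)) \<and> length as = Suc (Suc (length rest))"
    if "(q, rs, q', as) \<in> trans M" for q rs q' as
    using wf_machineD(3)[OF wf that] M_facts(1) len by linarith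
  have none: "lookup (the (orac M)) (Run q) c = None" for c using orac assms(3) by (cases c) simp
  have tr: "(to_nat (Run q), map scanned ?ts, p', bs) \<in> trans (simulator M) \<longleftrightarrow>
     (\<exists>q' as. (q, map scanned ts, q', as) \<in> trans M \<and> p' = to_nat (Run q') \<and> bs = ?bs as)" for p' bs
  proof
    assume "(to_nat (Run q), map scanned ?ts, p', bs) \<in> trans (simulator M)"
    moreover have "(to_nat (Run q), map scanned ?ts, p', bs) \<notin> lookup_trans M"
      unfolding lookup_trans_iff
    proof (intro notI, elim exE conjE)
      fix s c s' c' m b assume "to_nat (Run q) = to_nat s" "lookup (the (orac M)) s c = Some (s', c', m, b)"
      with none show False by simp
    qed
    ultimately have "(to_nat (Run q), map scanned ?ts, p', bs) \<in> run_trans M"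
      unfolding simulator_simps by blast
    then obtain rs q' as e where t: "(q, rs, q', as) \<in> trans M" "p' = to_nat (Run q')"
      and rs: "map scanned ?ts = rs ! 0 # cell (rs ! 1, e, False) # drop 2 rs @ [Aux 0]"
      and bs: "bs = as ! 0 # (cell (fst (as ! 1), e, False), snd (as ! 1)) # drop 2 as @ [(Aux 0, Right)]"
      unfolding run_trans_iff by auto
    obtain r0 r1 rr where "rs = r0 # r1 # rr" using l[OF t(1)] by (auto simp: length_Suc_conv)
    \<comment> \<open>Injectivity of \<open>cell\<close> recovers both the simulated symbol and the
      table entry from the scanned cell, so the choice of \<open>e\<close> is no extra
      nondeterminism.\<close>
    then have "rs = map scanned ts" "e = entry t 0 h" using rs unfolding ms by (auto simp: ts)
    with t bs show "\<exists>q' as. (q, map scanned ts, q', as) \<in> trans M \<and> p' = to_nat (Run q') \<and> bs = ?bs as" by blast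
  next
    assume "\<exists>q' as. (q, map scanned ts, q', as) \<in> trans M \<and> p' = to_nat (Run q') \<and> bs = ?bs as"
    then obtain q' as where "(q, map scanned ts, q', as) \<in> trans M" "p' = to_nat (Run q')" "bs = ?bs as" by blast
    moreover have "map scanned ?ts = map scanned ts ! 0 # cell (map scanned ts ! 1, entry t 0 h, False) #
        drop 2 (map scanned ts) @ [Aux 0]" unfolding ms by (simp add: ts)
    ultimately show "(to_nat (Run q), map scanned ?ts, p', bs) \<in> trans (simulator M)"
      unfolding simulator_simps Un_iff run_trans_iff
      by (intro disjI1 exI[of _ q] exI[of _ "map scanned ts"] exI[of _ q'] exI[of _ as]
          exI[of _ "entry t 0 h"] conjI refl)
  qed
  have ws: "(to_nat (Run q'), map2 write_move (?bs as) ?ts) = sim t (q', map2 write_move as ts) (Suc k)"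
    if tm: "(q, map scanned ts, q', as) \<in> trans M" for q' as
  proof -
    obtain b c d as' where as: "as = b # (c, d) # as'" and "length as' = length rest"
      using l[OF tm] by (auto simp: length_Suc_conv)
    then show ?thesis using assms(2) by (auto simp: sim_def scfg_def ts fun_eq_iff)
  qed
  have "orac M \<noteq> Some (q, y', n')" for y' n' using orac assms(3) by simp
  then have M: "step M K' (q, ts) c \<longleftrightarrow>
      (\<exists>q' as. (q, map scanned ts, q', as) \<in> trans M \<and> c = (q', map2 write_move as ts))" for c
    unfolding step_iff by blast
  have "step (simulator M) K (to_nat (Run q), ?ts) x \<longleftrightarrow>
     (\<exists>q' as. (q, map scanned ts, q', as) \<in> trans M \<and> x = (to_nat (Run q'), map2 write_move (?bs as) ?ts))"
    unfolding step_iff tr simulator_simps(4) by blast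
  also have "\<dots> \<longleftrightarrow> (\<exists>q' as. (q, map scanned ts, q', as) \<in> trans M \<and> x = sim t (q', map2 write_move as ts) (Suc k))"
    using ws by (intro ex_cong1 conj_cong) auto
  also have "\<dots> \<longleftrightarrow> (\<exists>c. step M K' (q, ts) c \<and> x = sim t c (Suc k))"
    unfolding M by blast
  finally show ?thesis unfolding sim .
qed

lemma simulator_query:
  assumes "inv k ts" "k < length t"
  shows "\<exists>m \<le> 4 * length t + 6. det_run (step (simulator M) K) m (sim t (p, ts) k)
    (sim t (reply (table_set t) ts y n, ts) (Suc k))"
proof -
  from assms(1) obtain a f h rest where ts: "ts = a # (f, h) # rest" and len: "length rest = tapes M - 2"
    and al: "range (fst a) \<subseteq> alphabet M" "range f \<subseteq> alphabet M" "\<forall>r\<in>set rest. range (fst r) \<subseteq> alphabet M"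
    and h: "\<bar>h\<bar> \<le> int k" and bl: "\<forall>i \<ge> int k. f i = Blank"
    unfolding inv_def by blast
  have sc: "scanned r \<in> alphabet M" if "range (fst r) \<subseteq> alphabet M" for r
    using that by (cases r) auto
  have "f (int k) = Blank" using bl by simp
  from query_run[where f = f and t = t and h = h and k = k, OF assms(2) h this] obtain m where m: "m \<le> 4 * length t + 6"
    "(lookup_step (length t) ^^ m) (Run p, \<lambda>i. (f i, entry t 0 i, False), h, k)
      (Run (if str_index (query_word (f, h)) \<in> table_set t then y else n), \<lambda>i. (f i, entry t 0 i, False), h, Suc k)"
    by blast
  have "det_run (step (simulator M) K) m (scfg a rest (length t) (Run p, \<lambda>i. (f i, entry t 0 i, False), h, k))
     (scfg a rest (length t)
       (Run (if str_index (query_word (f, h)) \<in> table_set t then y else n), \<lambda>i. (f i, entry t 0 i, False), h, Suc k))"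
    by (rule scfg_det_run[OF _ _ len _ m(2)]) (use sc al in auto)
  with m(1) show ?thesis by (auto simp: sim_def ts reply_def)
qed

text \<open>Induction on the number \<open>r\<close> of ticks left. A tick takes one step, or for a
  query a deterministic segment of at most \<open>4 * length t + 6\<close> steps, which can be
  skipped when asking whether an accepting state is reachable.\<close>

lemma simulator_behaviour:
  assumes "inv k ts" "k + r = length t"
  shows "(\<forall>l e. (step (simulator M) K ^^ l) (sim t (q, ts) k) e \<longrightarrow> l \<le> r * (4 * length t + 6)) \<and>
    ((\<exists>e. (step (simulator M) K)\<^sup>*\<^sup>* (sim t (q, ts) k) e \<and> fst e = accept (simulator M)) \<longleftrightarrow>
     (\<exists>j \<le> r. \<exists>d. (step M (table_set t) ^^ j) (q, ts) d \<and> fst d = accept M))"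
  using assms
proof (induction r arbitrary: k q ts)
  case 0
  have fst_sim: "fst (sim t (q, ts) k) = to_nat (Run q)"
    using 0 by (auto simp: inv_def sim_def scfg_def)
  \<comment> \<open>The clock head has left the marks and scans a blank, whereas every transition of
    the simulator requires \<open>Aux 0\<close> there.\<close>
  have no: "\<not> step (simulator M) K (sim t (q, ts) k) x" for x
    using 0 by (auto simp: inv_def sim_def scfg_def step_iff run_trans_iff lookup_trans_iff)
  then have "l = 0" if "(step (simulator M) K ^^ l) (sim t (q, ts) k) e" for l e
  proof (cases l)
    case (Suc i)
    with that obtain x where "step (simulator M) K (sim t (q, ts) k) x" by (meson relpowp_Suc_D2)
    with no show ?thesis by blast
  qed simp
  moreover have only: "e = sim t (q, ts) k" if "(step (simulator M) K)\<^sup>*\<^sup>* (sim t (q, ts) k) e" for e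
    using that no by (metis converse_rtranclpE)
  moreover have "(\<exists>e. (step (simulator M) K)\<^sup>*\<^sup>* (sim t (q, ts) k) e \<and> fst e = accept (simulator M)) \<longleftrightarrow> q = accept M"
  proof
    assume "\<exists>e. (step (simulator M) K)\<^sup>*\<^sup>* (sim t (q, ts) k) e \<and> fst e = accept (simulator M)"
    then have "fst (sim t (q, ts) k) = accept (simulator M)" using only by blast
    then show "q = accept M" unfolding fst_sim by simp
  next
    assume "q = accept M"
    then show "\<exists>e. (step (simulator M) K)\<^sup>*\<^sup>* (sim t (q, ts) k) e \<and> fst e = accept (simulator M)"
      using fst_sim by (intro exI[of _ "sim t (q, ts) k"]) simp
  qed
  moreover have "(\<exists>j \<le> 0. \<exists>d. (step M (table_set t) ^^ j) (q, ts) d \<and> fst d = accept M) \<longleftrightarrow> q = accept M"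
    by auto
  ultimately show ?case by blast
next
  case (Suc r)
  let ?S = "step (simulator M) K" and ?M = "step M (table_set t)" and ?B = "4 * length t + 6"
  let ?s = "sim t (q, ts) k"
  have k: "k < length t" "Suc k + r = length t" using Suc.prems by auto
  have fst_sim: "fst ?s = to_nat (Run q)"
    using Suc.prems by (auto simp: inv_def sim_def scfg_def)
  have IH: "(\<forall>l e. (?S ^^ l) (sim t c (Suc k)) e \<longrightarrow> l \<le> r * ?B) \<and>
      ((\<exists>e. ?S\<^sup>*\<^sup>* (sim t c (Suc k)) e \<and> fst e = accept (simulator M)) \<longleftrightarrow>
        (\<exists>j \<le> r. \<exists>d. (?M ^^ j) c d \<and> fst d = accept M))" if "?M (q, ts) c" for c
  proof (cases c)
    case (Pair q' ts')
    with that inv_step[OF Suc.prems(1)] have "inv (Suc k) ts'" by blast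
    from Suc.IH[OF this k(2)] show ?thesis unfolding Pair .
  qed
  have split: "(\<exists>j \<le> Suc r. \<exists>d. (?M ^^ j) (q, ts) d \<and> fst d = accept M) \<longleftrightarrow>
      q = accept M \<or> (\<exists>c. ?M (q, ts) c \<and> (\<exists>j \<le> r. \<exists>d. (?M ^^ j) c d \<and> fst d = accept M))"
    (is "?L \<longleftrightarrow> ?R")
  proof
    assume ?L
    then obtain j d where j: "j \<le> Suc r" "(?M ^^ j) (q, ts) d" "fst d = accept M" by blast
    show ?R
    proof (cases j)
      case 0
      with j show ?thesis by auto
    next
      case (Suc i)
      with j(2) obtain c where "?M (q, ts) c" "(?M ^^ i) c d" by (meson relpowp_Suc_D2)
      moreover have "i \<le> r" using j(1) Suc by simp
      ultimately show ?thesis using j(3) by blast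
    qed
  next
    assume ?R
    then show ?L
    proof (elim disjE exE conjE)
      assume "q = accept M"
      then show ?L by (intro exI[of _ 0] conjI exI[of _ "(q, ts)"]) auto
    next
      fix c j d assume "?M (q, ts) c" "j \<le> r" "(?M ^^ j) c d" "fst d = accept M"
      then show ?L using relpowp_Suc_I2 by (intro exI[of _ "Suc j"] conjI exI[of _ d]) auto
    qed
  qed
  show ?case
  proof (cases "q = p")
    case True
    let ?c = "(reply (table_set t) ts y n, ts)"
    from simulator_query[OF Suc.prems(1) k(1), of K] obtain m where m: "m \<le> ?B"
      "det_run ?S m ?s (sim t ?c (Suc k))" unfolding True by blast
    have only: "?M (q, ts) c \<longleftrightarrow> c = ?c" for c
      unfolding step_iff using True orac M_facts(3) by auto
    have "l \<le> Suc r * ?B" if "(?S ^^ l) ?s e" for l e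
    proof -
      have "l \<le> m + r * ?B" by (rule det_run_halts[OF m(2) _ that]) (use IH only in blast)
      then show ?thesis using m(1) by simp
    qed
    moreover have "(\<exists>e. ?S\<^sup>*\<^sup>* ?s e \<and> fst e = accept (simulator M)) \<longleftrightarrow>
        (\<exists>e. ?S\<^sup>*\<^sup>* (sim t ?c (Suc k)) e \<and> fst e = accept (simulator M))"
      by (rule det_run_reach_final[OF m(2)]) (use step_not_accept[OF wf_simulator] in blast)
    then have "(\<exists>e. ?S\<^sup>*\<^sup>* ?s e \<and> fst e = accept (simulator M)) \<longleftrightarrow>
        (\<exists>j \<le> Suc r. \<exists>d. (?M ^^ j) (q, ts) d \<and> fst d = accept M)"
      unfolding split using IH[of ?c] only True M_facts(2) by auto
    ultimately show ?thesis by blast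
  next
    case False
    note st = simulator_run_step[OF Suc.prems(1) k(1) False, of K _ "table_set t"]
    have "l \<le> Suc r * ?B" if "(?S ^^ l) ?s e" for l e
    proof (cases l)
      case (Suc i)
      with that obtain x where "?S ?s x" "(?S ^^ i) x e" by (meson relpowp_Suc_D2)
      then have "i \<le> r * ?B" using IH unfolding st by blast
      with Suc show ?thesis by simp
    qed simp
    moreover have "(\<exists>e. ?S\<^sup>*\<^sup>* ?s e \<and> fst e = accept (simulator M)) \<longleftrightarrow>
        q = accept M \<or> (\<exists>c. ?M (q, ts) c \<and> (\<exists>e. ?S\<^sup>*\<^sup>* (sim t c (Suc k)) e \<and> fst e = accept (simulator M)))"
      (is "?L \<longleftrightarrow> ?R")
    proof
      assume ?L
      then obtain e where e: "?S\<^sup>*\<^sup>* ?s e" "fst e = accept (simulator M)" by blast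
      from e(1) show ?R
      proof (cases rule: converse_rtranclpE)
        case base
        then show ?thesis using e(2) fst_sim by simp
      next
        case (step x)
        then show ?thesis using e(2) unfolding st by blast
      qed
    next
      assume ?R
      then show ?L
      proof (elim disjE exE conjE)
        assume "q = accept M"
        then show ?L using fst_sim by (intro exI[of _ ?s]) simp
      next
        fix c e assume c: "?M (q, ts) c" "?S\<^sup>*\<^sup>* (sim t c (Suc k)) e" "fst e = accept (simulator M)"
        then have "?S ?s (sim t c (Suc k))" unfolding st by blast
        with c show ?L by (meson converse_rtranclp_into_rtranclp)
      qed
    qed
    then have "(\<exists>e. ?S\<^sup>*\<^sup>* ?s e \<and> fst e = accept (simulator M)) \<longleftrightarrow>
        (\<exists>j \<le> Suc r. \<exists>d. (?M ^^ j) (q, ts) d \<and> fst d = accept M)"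
      unfolding split using IH by blast
    ultimately show ?thesis by blast
  qed
qed

text \<open>The second half is taken at face value as a table, and its length is also the bound on
  the number of steps, so membership refers to no oracle.\<close>

definition bounded_language :: "bool list set" where
  "bounded_language = {z. \<exists>j \<le> length (back_half z). \<exists>d.
     (step M (table_set (back_half z)) ^^ j) (initial M (strip (front_half z))) d \<and> fst d = accept M}"

text \<open>The decoder leaves exactly a simulated initial configuration: the input on tape 0, the
  table on tape 1, and on the last tape one clock mark per table entry.\<close>

lemma bounded_language_NP: "bounded_language \<in> NP_class"
proof -
  let ?N = "seq decode (simulator M)"
  have dec: "tapes decode = 3" "accept decode = 5" "start decode = 0" "orac decode = None \<or> orac (simulator M) = None"
    by (simp_all add: decode_def)
  have t3: "3 \<le> tapes (simulator M)" using M_facts(1) by simp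
  have main: "(accepts ?N {} z \<longleftrightarrow> z \<in> bounded_language) \<and>
     halts_within ?N {} z (poly [:6, 9, 4:] (length z))" for z
  proof -
    let ?t = "back_half z" and ?x = "strip (front_half z)"
    let ?ts = "[(bits ?x, 0), (\<lambda>i. cell (Blank, entry ?t 0 i, False), 0), (marks (length ?t), 0)]"
    obtain m where m: "m \<le> poly [:6, 3:] (length z)"
      and run: "(step decode {} ^^ m) (0, [(bits z, 0), (marks 0, 0), (marks 0, 0)]) (5, ?ts)"
      using decode_run by blast
    have "deterministic decode" unfolding decode_def by (rule deterministic_table_machine)
    then have dr: "det_run (step decode {}) m (start decode, [input_tape z, blank_tape, blank_tape]) (accept decode, ?ts)"
      unfolding dec input_tape_bits blank_tape_marks
      by (intro relpowp_det_run[OF run] step_deterministic[OF wf_decode])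
    have "tapes M - 1 = Suc (tapes M - 2)" "tapes M + 1 - 3 = tapes M - 2" using M_facts by linarith+
    then have c0: "(start (simulator M), three (tapes (simulator M) - 3) ?ts) = sim ?t (start M, snd (initial M ?x)) 0"
      by (simp add: three_def sim_def scfg_def initial_def blank_tape_def input_tape_bits)
    note sim = simulator_behaviour[where r = "length ?t" and t = ?t and K = "{}" and q = "start M",
        OF inv_initial[of ?x] add_0]
    note beh = seq_behaviour[OF wf_decode wf_simulator dec(1) t3 dec(4) dr, unfolded c0]
    have "accepts ?N {} z \<longleftrightarrow> z \<in> bounded_language"
      unfolding beh(1) using conjunct2[OF sim] by (simp add: bounded_language_def initial_def)
    moreover have "halts_within ?N {} z (m + length ?t * (4 * length ?t + 6))"
      by (rule beh(2)) (use conjunct1[OF sim] in blast)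
    \<comment> \<open>With \<open>N\<close> the length of \<open>z\<close>, this is the decoding
      bound 6 + 3N plus N(4N + 6) for the simulation.\<close>
    moreover have "m + length ?t * (4 * length ?t + 6) \<le> poly [:6, 9, 4:] (length z)"
    proof -
      have "length ?t \<le> length z" by simp
      then have "length ?t * (4 * length ?t + 6) \<le> length z * (4 * length z + 6)"
        by (intro mult_mono) auto
      with m show ?thesis by (simp add: algebra_simps)
    qed
    ultimately show ?thesis unfolding halts_within_def using le_trans by blast
  qed
  then have "bounded_language = language ?N {}" by (auto simp: language_def)
  moreover have "poly_time ?N {}" using main unfolding poly_time_def by blast
  moreover have "wf_machine ?N" by (rule wf_seq[OF wf_decode wf_simulator dec(1) t3 dec(4)])
  moreover have "ordinary ?N" by (simp add: ordinary_def seq_def decode_def)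
  ultimately show ?thesis unfolding NP_class_def by blast
qed

end

section \<open>Tally oracles\<close>

context oracle_machine
begin

text \<open>By the invariant the query word is shorter than the table. If it is a tally word, its
  entry is therefore present and correct; if not, it belongs neither to \<open>K\<close> nor to
  \<open>table_set t\<close>.\<close>

lemma step_table_set:
  assumes "inv k ts" "k < length t" "K \<subseteq> range tally" "t = map (\<lambda>i. tally i \<in> K) [0..<length t]"
  shows "step M (table_set t) (q, ts) = step M K (q, ts)"
proof -
  from assms(1) obtain a f h rest where ts: "ts = a # (f, h) # rest" and bl: "f (int k) = Blank"
    unfolding inv_def by blast
  have len: "length (query_word (f, h)) < length t"
    using query_word_length[of f k h] bl assms(2) by simp
  have "str_index (query_word (f, h)) \<in> table_set t \<longleftrightarrow> str_index (query_word (f, h)) \<in> K"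
  proof (cases "str_index (query_word (f, h)) \<in> range tally")
    case True
    then obtain i where i: "str_index (query_word (f, h)) = tally i" by blast
    then have "query_word (f, h) = replicate i False"
      using bij_str_index unfolding tally_def bij_def inj_def by blast
    then have il: "i < length t" using len by simp
    then have "t ! i \<longleftrightarrow> tally i \<in> K" by (subst assms(4)) simp
    then show ?thesis using il i inj_tally by (auto simp: table_set_def)
  next
    case False
    then show ?thesis using assms(3) by (auto simp: table_set_def)
  qed
  then have "reply (table_set t) ts y' n' = reply K ts y' n'" for y' n' by (simp add: reply_def ts)
  then show ?thesis by (intro ext) (simp add: step_iff)
qed

lemma relpowp_table_set:
  assumes "K \<subseteq> range tally" "t = map (\<lambda>i. tally i \<in> K) [0..<length t]" "l \<le> length t"
  shows "(step M (table_set t) ^^ l) (initial M x) c \<longleftrightarrow> (step M K ^^ l) (initial M x) c"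
  using assms(3)
proof (induction l arbitrary: c)
  case (Suc l)
  have same: "step M (table_set t) d = step M K d" if "(step M K ^^ l) (initial M x) d" for d
  proof -
    have "inv l (snd d)" by (rule inv_relpowp[OF that])
    with step_table_set[OF _ _ assms(1,2), of l "snd d" "fst d"] Suc.prems show ?thesis by simp
  qed
  show ?case
    unfolding relpowp.simps relcompp_apply using Suc.IH[OF Suc_leD[OF Suc.prems]] same by metis
qed simp

end

section \<open>Padding beyond a polynomial bound\<close>

lemma pad_power: "\<exists>m. (pad ^^ j) (x @ [True]) = x @ True # replicate m False"
proof (induction j)
  case 0
  show ?case by (rule exI[of _ 0]) simp
next
  case (Suc j)
  then obtain m where "(pad ^^ j) (x @ [True]) = x @ True # replicate m False" by blast
  then have "(pad ^^ Suc j) (x @ [True]) = x @ True # replicate (m + (length x + Suc m) * (length x + Suc m)) False"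
    by (simp add: pad_def replicate_add replicate_app_Cons_same)
  then show ?case by blast
qed

text \<open>The first padding turns length n + 1 into (n + 1)(n + 2), which secures the base n + 2;
  each of the other \<open>j\<close> paddings at least squares the length.\<close>

lemma length_pad_power: "(length x + 2) ^ (2 ^ j) \<le> length ((pad ^^ Suc j) (x @ [True]))"
proof (induction j)
  case 0
  show ?case by (simp add: pad_def)
next
  case (Suc j)
  let ?l = "length ((pad ^^ Suc j) (x @ [True]))"
  have "(length x + 2) ^ (2 ^ Suc j) = (length x + 2) ^ (2 ^ j) * (length x + 2) ^ (2 ^ j)"
    by (simp add: power_mult_distrib mult_2 power_add)
  also have "\<dots> \<le> ?l * ?l" using Suc by (intro mult_mono zero_le)
  also have "length u * length u \<le> length (pad u)" for u by (simp add: pad_def)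
  finally show ?case by (simp only: funpow.simps(2) o_apply)
qed

text \<open>The base is at least 2 for every \<open>n\<close>, so coefficients can be absorbed into
  the exponent.\<close>

lemma poly_nat_le_power: "\<exists>d. \<forall>n. poly p n < (n + 2) ^ d" for p :: "nat poly"
proof (induction p)
  case 0
  show ?case by (rule exI[of _ 0]) simp
next
  case (pCons a p)
  then obtain d where d: "\<And>n. poly p n < (n + 2) ^ d" by blast
  \<comment> \<open>Both summands are bounded by exponent \<open>a + d + 1\<close>, the constant
    because of \<open>a < 2 ^ a\<close>; the factor 2 from adding them costs one more factor n +
    2.\<close>
  have "poly (pCons a p) n < (n + 2) ^ (a + d + 2)" for n
  proof -
    have "a < 2 ^ a" by (rule less_exp)
    also have "(2::nat) ^ a \<le> (n + 2) ^ a" by (intro power_mono) simp_all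
    also have "\<dots> \<le> (n + 2) ^ (a + d + 1)" by (intro power_increasing) simp_all
    finally have "a < (n + 2) ^ (a + d + 1)" .
    moreover have "n * poly p n \<le> (n + 2) * (n + 2) ^ d"
      using d[of n] by (intro mult_mono) simp_all
    then have "n * poly p n \<le> (n + 2) ^ (d + 1)" by simp
    then have "n * poly p n \<le> (n + 2) ^ (a + d + 1)"
      using power_increasing[of "d + 1" "a + d + 1" "n + 2"] by simp
    ultimately have "a + n * poly p n < 2 * (n + 2) ^ (a + d + 1)" by linarith
    also have "\<dots> \<le> (n + 2) * (n + 2) ^ (a + d + 1)" by (intro mult_right_mono) simp_all
    finally show ?thesis by simp
  qed
  then show ?case by blast
qed

section \<open>Reductions and collapse relative to a tally oracle\<close>

lemma P_subset_P_oracle: "P_class \<subseteq> P_oracle K"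
proof
  fix L assume "L \<in> P_class"
  then obtain D where "wf_machine D" "ordinary D" "deterministic D" "poly_time D {}" "L = language D {}"
    unfolding P_class_def by blast
  then show "L \<in> P_oracle K"
    using ordinary_language[of D K "{}"] ordinary_poly_time[of D K "{}"] unfolding P_oracle_def by auto
qed

text \<open>The decider of \<open>L\<close> is ordinary, so the single query state of the composite
  is free for the tabulating machine.\<close>

lemma P_oracle_vimage_table:
  assumes "L \<in> P_class"
  shows "with_table K -` L \<in> P_oracle K"
proof -
  obtain D where D: "wf_machine D" "ordinary D" "deterministic D" "poly_time D {}" "L = language D {}"
    using assms unfolding P_class_def by blast
  have L: "L = language D K" using ordinary_language[OF D(2), of "{}" K] D(5) by simp
  have pt: "poly_time D K" using ordinary_poly_time[OF D(2), of "{}" K] D(4) by simp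
  have "orac D = None" using D(2) by (simp add: ordinary_def)
  then show ?thesis
    unfolding L using P_oracle_vimage[OF transduces_tabulate D(1,3) pt] by blast
qed

lemma P_oracle_vimage_pad: "L \<in> P_oracle K \<Longrightarrow> (pad ^^ j) -` L \<in> P_oracle K"
proof (induction j arbitrary: L)
  case (Suc j)
  have "ordinary square" by (simp add: ordinary_def square_def)
  with P_oracle_vimage_ordinary[OF transduces_square] Suc.prems have "pad -` L \<in> P_oracle K" by blast
  from Suc.IH[OF this] show ?case by (simp add: vimage_def)
qed (simp add: vimage_def)

text \<open>The language of \<open>M\<close> is pulled back from \<open>bounded_language\<close>,
  which P = NP puts into P, along appending the marker, padding and tabulating. Only the last of
  these maps consults \<open>K\<close>.\<close>

lemma (in oracle_machine) language_in_P_oracle: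
  assumes "K \<subseteq> range tally" "poly_time M K" "P_class = NP_class"
  shows "language M K \<in> P_oracle K"
proof -
  obtain b :: "nat poly" where b: "\<And>x. halts_within M K x (poly b (length x))"
    using assms(2) unfolding poly_time_def by blast
  obtain d where d: "\<And>m. poly b m < (m + 2) ^ d" using poly_nat_le_power by blast
  \<comment> \<open>Here \<open>d\<close> bounds the exponent of the running time. Since d is at
    most 2^d, \<open>Suc d\<close> paddings reach that bound, the first of them providing the base n
    + 2.\<close>
  define g where "g = (\<lambda>x. (pad ^^ Suc d) (x @ [True]))"
  have long: "poly b (length x) \<le> length (g x)" for x
  proof -
    have "poly b (length x) \<le> (length x + 2) ^ d" using d[of "length x"] by simp
    also have "\<dots> \<le> (length x + 2) ^ (2 ^ d)" by (intro power_increasing) (simp_all add: less_imp_le)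
    also have "\<dots> \<le> length (g x)" unfolding g_def by (rule length_pad_power)
    finally show ?thesis .
  qed
  have "with_table K -` bounded_language \<in> P_oracle K"
    using P_oracle_vimage_table bounded_language_NP assms(3) by simp
  then have "(pad ^^ Suc d) -` (with_table K -` bounded_language) \<in> P_oracle K"
    by (rule P_oracle_vimage_pad)
  moreover have "ordinary append_one" by (simp add: ordinary_def append_one_def)
  ultimately have "(\<lambda>x. x @ [True]) -` ((pad ^^ Suc d) -` (with_table K -` bounded_language)) \<in> P_oracle K"
    using P_oracle_vimage_ordinary[OF transduces_append_one] by blast
  moreover have "(\<lambda>x. x @ [True]) -` ((pad ^^ Suc d) -` (with_table K -` bounded_language)) = language M K"
  proof -
    have "with_table K (g x) \<in> bounded_language \<longleftrightarrow> accepts M K x" for x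
    proof -
      define t where "t = map (\<lambda>i. tally i \<in> K) [0..<length (g x)]"
      have t: "t = map (\<lambda>i. tally i \<in> K) [0..<length t]" by (simp add: t_def)
      have "with_table K (g x) = g x @ t" by (simp add: with_table_def t_def)
      then have halves: "front_half (with_table K (g x)) = g x" "back_half (with_table K (g x)) = t"
        using halves_append[of "g x" t] by (simp_all add: t_def)
      have strip: "strip (g x) = x" using pad_power[of "Suc d" x] strip_replicate unfolding g_def by auto
      have "with_table K (g x) \<in> bounded_language \<longleftrightarrow>
         (\<exists>j \<le> length t. \<exists>e. (step M (table_set t) ^^ j) (initial M x) e \<and> fst e = accept M)"
        by (simp only: bounded_language_def mem_Collect_eq halves strip)
      also have "\<dots> \<longleftrightarrow> (\<exists>j \<le> length t. \<exists>e. (step M K ^^ j) (initial M x) e \<and> fst e = accept M)"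
        using relpowp_table_set[OF assms(1) t] by blast
      also have "\<dots> \<longleftrightarrow> accepts M K x"
      proof
        assume "accepts M K x"
        then obtain j e where j: "(step M K ^^ j) (initial M x) e" "fst e = accept M"
          unfolding accepts_def rtranclp_power by blast
        have "j \<le> poly b (length x)" using b[of x] j(1) unfolding halts_within_def by blast
        also have "\<dots> \<le> length t" using long[of x] by (simp add: t_def)
        finally show "\<exists>j \<le> length t. \<exists>e. (step M K ^^ j) (initial M x) e \<and> fst e = accept M" using j by blast
      qed (auto simp: accepts_def rtranclp_power)
      finally show ?thesis .
    qed
    then show ?thesis unfolding g_def language_def vimage_def by (simp only: mem_Collect_eq)
  qed
  ultimately show ?thesis by simp
qed

lemma tally_oracle_collapse:
  assumes "P_class = NP_class" "K \<subseteq> range tally"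
  shows "P_oracle K = NP_oracle K"
proof
  show "P_oracle K \<subseteq> NP_oracle K" unfolding P_oracle_def NP_oracle_def by blast
  show "NP_oracle K \<subseteq> P_oracle K"
  proof
    fix L assume "L \<in> NP_oracle K"
    then obtain M where M: "wf_machine M" "poly_time M K" "L = language M K" unfolding NP_oracle_def by blast
    show "L \<in> P_oracle K"
    proof (cases "orac M")
      case None
      then have o: "ordinary M" by (simp add: ordinary_def)
      then have "L \<in> NP_class"
        unfolding NP_class_def using M ordinary_language[OF o, of K "{}"] ordinary_poly_time[OF o, of K "{}"] by auto
      then show ?thesis using assms(1) P_subset_P_oracle by blast
    next
      case (Some r)
      then obtain p y n where "orac M = Some (p, y, n)" by (cases r) auto
      with M(1) interpret oracle_machine M p y n by unfold_locales
      show ?thesis unfolding M(3) by (rule language_in_P_oracle[OF assms(2) M(2) assms(1)])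
    qed
  qed
qed

theorem theorem3p6:
  assumes "ramsey_large {K :: nat set. infinite K \<and> P_oracle K \<noteq> NP_oracle K}"
  shows "P_class \<noteq> NP_class"
proof
  assume eq: "P_class = NP_class"
  have "inj tally" using inj_tally by (auto intro: injI)
  then have "infinite (range tally)" by (rule range_inj_infinite)
  from ramsey_large_meets[OF assms this] obtain K where "P_oracle K \<noteq> NP_oracle K" "K \<subseteq> range tally" by blast
  with tally_oracle_collapse[OF eq] show False by blast
qed

end
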